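(* Let $\mathsf L(x)=\mathfrak L(L(x),R_\perp)$ be a composite with $L(x)$ real symmetric and $L(x)>\frac12 I_2$. Then its effective tensor is $\mathsf L^*=\mathfrak L(L_*,R_\perp)$ with \[ L_*=\langle L^{-1}\rangle^{-1},\qquad \langle L^{-1}\rangle=\int_{[0,1]^2}L(x)^{-1}\,dx . \]
   Context: Let $R_\perp=\begin{pmatrix}0&-1\\1&0\end{pmatrix}$ and let $I_2$ be the $2\times2$ identity. Let $\mathcal T=\mathbb R^2\oplus\mathbb R^2$. Operators on $\mathcal T$ are written as $2\times2$ block matrices with real $2\times 2$ blocks, and $A\otimes B$ is the block matrix with blocks $A_{ij}B$. Put $\mathsf T=R_\perp\otimes R_\perp$. $\mathrm{Sym}^+(\mathcal T)$ is the set of symmetric positive definite operators on $\mathcal T$. For real $2\times2$ matrices $L=L^T$ and $M$, \[ \mathfrak L(L,M)=\begin{pmatrix} L & LM \\ {M^T}L & {M^T}LM \end{pmatrix}+\mathsf T . \] Inequalities between matrices are in the sense of quadratic forms; $L>\frac12I_2$ makes $\mathfrak L(L,R_\perp)$ positive definite. A composite is a $[0,1]^2$-periodic measurable map $\mathsf L:\mathbb R^2\to\mathrm{Sym}^+(\mathcal T)$ with values in a compact subset of $\mathrm{Sym}^+(\mathcal T)$. Its effective tensor $\mathsf L^*\in\mathrm{Sym}^+(\mathcal T)$ is defined by $\mathsf L^*E_0=\int_{[0,1]^2}\mathsf L(x)E(x)\,dx$ for $E_0\in\mathcal T$, where $E=E_0+(\nabla\varphi_1,\nabla\varphi_2)$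 with $\varphi_1,\varphi_2\in H^1_{\rm per}$ is the unique such field for which both $\mathbb R^2$-components of $\mathsf L E$ are divergence-free. *)

theory Defs
  imports "HOL-Analysis.Analysis"
begin

text \<open>
  The space \<open>\<T> = \<real>\<^sup>2 \<oplus> \<real>\<^sup>2\<close> is \<open>real^2^2\<close>: \<open>E $ i\<close> is the \<open>i\<close>-th \<open>\<real>\<^sup>2\<close>-component of \<open>E\<close>, and
  \<open>E \<bullet> F\<close> is the Euclidean inner product of \<open>\<T>\<close>.  An operator on \<open>\<T>\<close> is a block matrix of type
  \<open>(real^2^2)^2^2\<close>, with \<open>A $ i $ j\<close> its block in block row \<open>i\<close> and block column \<open>j\<close>.
\<close>

type_synonym field_space = "real^2^2"
type_synonym block_op = "(real^2^2)^2^2"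

definition block_app :: "block_op \<Rightarrow> field_space \<Rightarrow> field_space" where
  "block_app A E = (\<chi> i. \<Sum>j\<in>UNIV. A $ i $ j *v E $ j)"

definition Sym_pos :: "block_op set" where
  "Sym_pos = {A. (\<forall>E F. block_app A E \<bullet> F = E \<bullet> block_app A F) \<and>
                 (\<forall>E. E \<noteq> 0 \<longrightarrow> 0 < E \<bullet> block_app A E)}"

definition qf_less :: "real^2^2 \<Rightarrow> real^2^2 \<Rightarrow> bool" where
  "qf_less A B \<longleftrightarrow> (\<forall>v. v \<noteq> 0 \<longrightarrow> v \<bullet> (A *v v) < v \<bullet> (B *v v))"

definition block_tensor :: "real^2^2 \<Rightarrow> real^2^2 \<Rightarrow> block_op" where
  "block_tensor A B = (\<chi> i j. (A $ i $ j) *\<^sub>R B)"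

definition R_perp :: "real^2^2" where
  "R_perp = vector [vector [0, -1], vector [1, 0]]"

definition T_op :: block_op where
  "T_op = block_tensor R_perp R_perp"

definition frakL :: "real^2^2 \<Rightarrow> real^2^2 \<Rightarrow> block_op" where
  "frakL L M = vector [vector [L, L ** M],
                       vector [transpose M ** L, transpose M ** L ** M]] + T_op"

definition cell_periodic :: "(real^2 \<Rightarrow> 'b) \<Rightarrow> bool" where
  "cell_periodic f \<longleftrightarrow> (\<forall>x i. f (x + axis i 1) = f x)"

abbreviation cell_measure :: "(real^2) measure" where
  "cell_measure \<equiv> lebesgue_on (cbox 0 1)"

definition composite :: "(real^2 \<Rightarrow> block_op) \<Rightarrow> bool" where
  "composite L \<longleftrightarrow> cell_periodic L \<and> L \<in> borel_measurable lebesgue \<and>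
     (\<exists>K. compact K \<and> K \<subseteq> Sym_pos \<and> range L \<subseteq> K)"

definition L2_cell :: "(real^2 \<Rightarrow> 'b::euclidean_space) \<Rightarrow> bool" where
  "L2_cell f \<longleftrightarrow> f \<in> borel_measurable cell_measure \<and>
     integrable cell_measure (\<lambda>x. (norm (f x))\<^sup>2)"

text \<open>
  \<open>D [i\<^sub>1, \<dots>, i\<^sub>k]\<close> is the iterated partial derivative of \<open>f\<close> in the coordinates
  \<open>i\<^sub>k, \<dots>, i\<^sub>1\<close>; all of these are required to exist and to be differentiable, so \<open>f\<close> is \<open>C\<^sup>\<infinity>\<close>.
\<close>

definition smooth :: "(real^2 \<Rightarrow> real) \<Rightarrow> bool" where
  "smooth f \<longleftrightarrow> (\<exists>D :: 2 list \<Rightarrow> real^2 \<Rightarrow> real. D [] = f \<and>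
     (\<forall>is x. (D is has_derivative (\<lambda>h. \<Sum>i\<in>UNIV. D (i # is) x * h $ i)) (at x)))"

definition smooth_per :: "(real^2 \<Rightarrow> real) set" where
  "smooth_per = {f. smooth f \<and> cell_periodic f}"

definition grad :: "(real^2 \<Rightarrow> real) \<Rightarrow> real^2 \<Rightarrow> real^2" where
  "grad f x = (\<chi> i. frechet_derivative f (at x) (axis i 1))"

text \<open>
  \<open>H\<^sup>1\<^sub>p\<^sub>e\<^sub>r\<close> is the closure of the smooth periodic functions in the norm of \<open>H\<^sup>1([0,1]\<^sup>2)\<close>.
  \<open>H1_per_grad \<phi> G\<close> states that \<open>\<phi> \<in> H\<^sup>1\<^sub>p\<^sub>e\<^sub>r\<close> and that \<open>G\<close> is (a periodic representative of) its weak
  gradient \<open>\<nabla>\<phi>\<close>.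
\<close>

definition H1_per_grad :: "(real^2 \<Rightarrow> real) \<Rightarrow> (real^2 \<Rightarrow> real^2) \<Rightarrow> bool" where
  "H1_per_grad \<phi> G \<longleftrightarrow>
     cell_periodic \<phi> \<and> cell_periodic G \<and> L2_cell \<phi> \<and> L2_cell G \<and>
     (\<exists>\<psi> :: nat \<Rightarrow> real^2 \<Rightarrow> real. (\<forall>n. \<psi> n \<in> smooth_per) \<and>
        (\<lambda>n. LINT x|cell_measure. (\<psi> n x - \<phi> x)\<^sup>2) \<longlonglongrightarrow> 0 \<and>
        (\<lambda>n. LINT x|cell_measure. (norm (grad (\<psi> n) x - G x))\<^sup>2) \<longlonglongrightarrow> 0)"

text \<open>
  Divergence-free in the weak sense for a periodic field: \<open>\<integral> J \<cdot> \<nabla>\<psi> = 0\<close> for all smooth periodic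
  \<open>\<psi>\<close>, the integral being over one period cell.
\<close>

definition div_free :: "(real^2 \<Rightarrow> real^2) \<Rightarrow> bool" where
  "div_free J \<longleftrightarrow> cell_periodic J \<and> L2_cell J \<and>
     (\<forall>\<psi>\<in>smooth_per. (LINT x|cell_measure. J x \<bullet> grad \<psi> x) = 0)"

definition cell_field ::
  "(real^2 \<Rightarrow> block_op) \<Rightarrow> field_space \<Rightarrow> (real^2 \<Rightarrow> field_space) \<Rightarrow> bool" where
  "cell_field L E0 E \<longleftrightarrow>
     (\<exists>\<phi> G. (\<forall>i::2. H1_per_grad (\<phi> i) (G i)) \<and> E = (\<lambda>x. E0 + (\<chi> i. G i x))) \<and>
     (\<forall>i. div_free (\<lambda>x. block_app (L x) (E x) $ i))"

text \<open>
  Fields are identified when they agree almost everywhere.  The existence and uniqueness of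
  \<open>E\<close> are part of the definition, so that it determines \<open>A\<close>.
\<close>

definition has_effective_tensor :: "(real^2 \<Rightarrow> block_op) \<Rightarrow> block_op \<Rightarrow> bool"
    (infix "has'_effective'_tensor" 50) where
  "L has_effective_tensor A \<longleftrightarrow> A \<in> Sym_pos \<and>
     (\<forall>E0. \<exists>E. cell_field L E0 E \<and>
        (\<forall>E'. cell_field L E0 E' \<longrightarrow> (AE x in cell_measure. E' x = E x)) \<and>
        block_app A E0 = (LINT x|cell_measure. block_app (L x) (E x)))"

lemma block_app_eqD:
  assumes "\<And>E. block_app A E = block_app B E"
  shows "A = B"
proof -
  have "A $ i $ j *v v = B $ i $ j *v v" for i j v
  proof -
    have "block_app A (axis j v) $ i = block_app B (axis j v) $ i"
      using assms by simp
    moreover have "block_app C (axis j v) $ i = C $ i $ j *v v" for C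
    proof -
      have "block_app C (axis j v) $ i = (\<Sum>k\<in>UNIV. if k = j then C $ i $ k *v v else 0)"
        unfolding block_app_def vec_lambda_beta by (rule sum.cong) (auto simp: axis_def)
      also have "\<dots> = C $ i $ j *v v"
        by (subst sum.delta) auto
      finally show ?thesis .
    qed
    ultimately show ?thesis by simp
  qed
  then have "A $ i $ j = B $ i $ j" for i j
    by (simp add: matrix_eq)
  then show ?thesis
    by (simp add: vec_eq_iff)
qed

lemma has_effective_tensor_unique:
  assumes "L has_effective_tensor A" "L has_effective_tensor B"
  shows "A = B"
proof (rule block_app_eqD)
  fix E0
  obtain E where E: "cell_field L E0 E"
    "\<And>E'. cell_field L E0 E' \<Longrightarrow> AE x in cell_measure. E' x = E x"
    "block_app A E0 = (LINT x|cell_measure. block_app (L x) (E x))"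
    using assms(1) unfolding has_effective_tensor_def by blast
  obtain F where F: "cell_field L E0 F"
    "block_app B E0 = (LINT x|cell_measure. block_app (L x) (F x))"
    using assms(2) unfolding has_effective_tensor_def by blast
  have meas: "(\<lambda>x. block_app (L x) (H x)) \<in> borel_measurable cell_measure"
    if "cell_field L E0 H" for H
  proof -
    have "(\<lambda>x. block_app (L x) (H x) $ i) \<in> borel_measurable cell_measure" for i
      using that unfolding cell_field_def div_free_def L2_cell_def by blast
    then have "(\<lambda>x. block_app (L x) (H x) $ i \<bullet> axis k 1) \<in> borel_measurable cell_measure" for i k
      by (intro borel_measurable_inner) auto
    then show ?thesis
      by (subst borel_measurable_euclidean_space) (auto simp: Basis_vec_def inner_axis)
  qed
  have "(LINT x|cell_measure. block_app (L x) (F x)) = (LINT x|cell_measure. block_app (L x) (E x))"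
    using E(2)[OF F(1)] by (intro integral_cong_AE meas E F) auto
  then show "block_app A E0 = block_app B E0"
    using E(3) F(2) by simp
qed

end

(* With e = E_1 + R E_2 and j = L e (R = R_perp), the two components of the flux are
   J_1 = j - R E_2 and J_2 = - R j + R E_1.  Since R E_1 and R E_2 are divergence-free, the cell
   problem says that j is both divergence-free and curl-free, i.e. constant: e = L^{-1} j_0, and
   averaging gives e_0 = <L^{-1}> j_0, where e_0 is the value of e for the mean field E_0.  What remains
   is to realise the mean-zero field L^{-1} j_0 - e_0 as grad u + R grad v with periodic u, v
   (Helmholtz decomposition).  For trigonometric polynomials this follows by inverting the Laplacian
   mode by mode, and the general case by density, since grad u and R grad v are orthogonal in L^2;
   the Poincare inequality then controls the potentials. *)

theory Submission
  imports Defs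
begin

section \<open>Square-integrable fields on the period cell\<close>

text \<open>The constant 1/2 is the strength of \<open>T_op\<close>: with R = \<open>R_perp\<close>,
  its quadratic form is half of |E_1 - R E_2|^2 minus half of |E_1 + R E_2|^2, so L > 1/2 I_2 is
  what pays for the negative square. For the inverse the condition reads 0 < L^{-1} < 2 I_2, which
  survives averaging; inverting once more gives L_* > 1/2 I_2, so the candidate tensor is again
  positive definite. The same bound makes L^{-1} j_0 a bounded field, and the approximation argument
  is set up for bounded fields. Uniqueness of the cell field is an energy argument: the difference
  of two solutions is orthogonal in L^2 to the difference of their fluxes, while pointwise this
  product is positive wherever the solutions differ. The Helmholtz decomposition identifies fields
  only almost everywhere, whereas periodicity is demanded at every point. The flux is therefore
  compared with an explicit divergence-free field, and its periodicity is checked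
  separately.\<close>

lemma finite_measure_cell: "finite_measure cell_measure"
  by (rule finite_measureI)
    (use emeasure_lborel_cbox_finite[of 0 "1::real^2"] in
      \<open>auto simp: emeasure_restrict_space space_restrict_space\<close>)

lemma measure_cell: "measure cell_measure (space cell_measure) = 1"
proof -
  have "measure cell_measure (space cell_measure) = measure lebesgue (cbox 0 (1::real^2))"
    by (subst measure_restrict_space) (auto simp: space_restrict_space)
  also have "\<dots> = 1"
  proof -
    have "0 \<in> cbox 0 (1::real^2)" by (simp add: mem_box_cart)
    then have "cbox 0 (1::real^2) \<noteq> {}" by blast
    then show ?thesis by (simp add: content_cbox_cart)
  qed
  finally show ?thesis .
qed

lemma integral_cell_const:
  fixes c :: "'b::euclidean_space"
  shows "(LINT x|cell_measure. c) = c"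
  by (simp only: lebesgue_integral_const measure_cell scaleR_one)

lemma integrable_cell_bounded:
  fixes f :: "real^2 \<Rightarrow> 'b::euclidean_space"
  assumes "f \<in> borel_measurable cell_measure" "\<And>x. x \<in> cbox 0 1 \<Longrightarrow> norm (f x) \<le> B"
  shows "integrable cell_measure f"
  by (rule finite_measure.integrable_const_bound[OF finite_measure_cell, where B=B])
    (use assms in \<open>auto simp: space_restrict_space intro!: AE_I2\<close>)

lemma L2_cellI_bounded:
  fixes f :: "real^2 \<Rightarrow> 'b::euclidean_space"
  assumes [measurable]: "f \<in> borel_measurable cell_measure"
    and B: "\<And>x. x \<in> cbox 0 1 \<Longrightarrow> norm (f x) \<le> B"
  shows "L2_cell f"
  unfolding L2_cell_def
proof
  show "integrable cell_measure (\<lambda>x. (norm (f x))\<^sup>2)"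
    by (rule integrable_cell_bounded[where B="B\<^sup>2"]) (auto intro!: power_mono B)
qed fact

lemma measurable_cell_continuous:
  fixes f :: "real^2 \<Rightarrow> 'b::euclidean_space"
  shows "continuous_on UNIV f \<Longrightarrow> f \<in> borel_measurable cell_measure"
  by (intro continuous_imp_measurable_on_sets_lebesgue) (auto intro: continuous_on_subset)

lemma L2_cell_continuous:
  fixes f :: "real^2 \<Rightarrow> 'b::euclidean_space"
  assumes "continuous_on UNIV f"
  shows "L2_cell f"
proof -
  have "compact (f ` cbox 0 1)"
    by (intro compact_continuous_image compact_cbox continuous_on_subset[OF assms]) auto
  then obtain B where "\<And>x. x \<in> cbox 0 1 \<Longrightarrow> norm (f x) \<le> B"
    by (meson bounded_iff compact_imp_bounded image_eqI)
  then show ?thesis using L2_cellI_bounded measurable_cell_continuous[OF assms] by blast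
qed

lemma integrable_cell_continuous:
  fixes f :: "real^2 \<Rightarrow> 'b::euclidean_space"
  assumes "continuous_on UNIV f"
  shows "integrable cell_measure f"
proof -
  have "compact (f ` cbox 0 1)"
    by (intro compact_continuous_image compact_cbox continuous_on_subset[OF assms]) auto
  then obtain B where "\<And>x. x \<in> cbox 0 1 \<Longrightarrow> norm (f x) \<le> B"
    by (meson bounded_iff compact_imp_bounded image_eqI)
  then show ?thesis using integrable_cell_bounded measurable_cell_continuous[OF assms] by blast
qed

lemma L2_cell_measurable: "L2_cell f \<Longrightarrow> f \<in> borel_measurable cell_measure"
  by (simp add: L2_cell_def)

lemma L2_cell_bound:
  fixes f :: "real^2 \<Rightarrow> 'b::euclidean_space"
  assumes "f \<in> borel_measurable cell_measure" "integrable cell_measure h"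
    "\<And>x. (norm (f x))\<^sup>2 \<le> h x"
  shows "L2_cell f"
  unfolding L2_cell_def
proof
  show "integrable cell_measure (\<lambda>x. (norm (f x))\<^sup>2)"
    by (rule Bochner_Integration.integrable_bound[OF assms(2)])
      (use assms in \<open>auto intro!: AE_I2 intro: order_trans[OF _ abs_ge_self]\<close>)
qed fact

text \<open>The difference of the two sides is |a - b|^2. This is the triangle inequality used
  throughout for squared L^2 distances, so that no square roots of integrals are needed.\<close>

lemma norm_add_square_le:
  fixes a b :: "'b::real_inner"
  shows "(norm (a + b))\<^sup>2 \<le> 2 * (norm a)\<^sup>2 + 2 * (norm b)\<^sup>2"
proof -
  have "0 \<le> (norm (a - b))\<^sup>2" by simp
  then show ?thesis
    by (simp add: power2_norm_eq_inner algebra_simps inner_commute)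
qed

lemma L2_cell_add:
  fixes f g :: "real^2 \<Rightarrow> 'b::euclidean_space"
  assumes "L2_cell f" "L2_cell g"
  shows "L2_cell (\<lambda>x. f x + g x)"
  by (rule L2_cell_bound[where h="\<lambda>x. 2 * (norm (f x))\<^sup>2 + 2 * (norm (g x))\<^sup>2"])
    (use assms in \<open>auto simp: L2_cell_def norm_add_square_le\<close>)

lemma L2_cell_linear:
  fixes f :: "real^2 \<Rightarrow> 'b::euclidean_space" and T :: "'b \<Rightarrow> 'c::euclidean_space"
  assumes "L2_cell f" "bounded_linear T"
  shows "L2_cell (\<lambda>x. T (f x))"
proof -
  obtain K where K: "\<And>x. norm (T x) \<le> norm x * K" using bounded_linear.bounded[OF assms(2)] by blast
  have T: "T \<in> borel_measurable borel"
    by (intro borel_measurable_continuous_onI linear_continuous_on assms)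
  show ?thesis
  proof (rule L2_cell_bound[where h="\<lambda>x. (norm (f x))\<^sup>2 * K\<^sup>2"])
    show "(\<lambda>x. T (f x)) \<in> borel_measurable cell_measure"
      using L2_cell_measurable[OF assms(1)] T by (rule measurable_compose)
    show "integrable cell_measure (\<lambda>x. (norm (f x))\<^sup>2 * K\<^sup>2)"
      using assms(1) by (auto simp: L2_cell_def)
    show "(norm (T (f x)))\<^sup>2 \<le> (norm (f x))\<^sup>2 * K\<^sup>2" for x
      using power_mono[OF K[of "f x"], of 2] by (simp add: power_mult_distrib)
  qed
qed

lemma L2_cell_diff:
  fixes f g :: "real^2 \<Rightarrow> 'b::euclidean_space"
  assumes "L2_cell f" "L2_cell g"
  shows "L2_cell (\<lambda>x. f x - g x)"
  using L2_cell_add[OF assms(1) L2_cell_linear[OF assms(2) bounded_linear_minus[OF bounded_linear_ident]]]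
  by simp

lemma L2_cell_const: "L2_cell (\<lambda>x. c::'b::euclidean_space)"
  by (rule L2_cell_continuous) auto

lemma integrable_L2_inner:
  fixes f g :: "real^2 \<Rightarrow> 'b::euclidean_space"
  assumes "L2_cell f" "L2_cell g"
  shows "integrable cell_measure (\<lambda>x. f x \<bullet> g x)"
proof (rule Bochner_Integration.integrable_bound)
  show "integrable cell_measure (\<lambda>x. (norm (f x))\<^sup>2 + (norm (g x))\<^sup>2)"
    using assms by (auto simp: L2_cell_def)
  show "(\<lambda>x. f x \<bullet> g x) \<in> borel_measurable cell_measure"
    using assms by (auto simp: L2_cell_def)
  have "\<bar>a \<bullet> b\<bar> \<le> (norm a)\<^sup>2 + (norm b)\<^sup>2" for a b :: 'b
  proof -
    have "\<bar>a \<bullet> b\<bar> \<le> norm a * norm b" by (rule Cauchy_Schwarz_ineq2)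
    moreover have "2 * (norm a * norm b) \<le> (norm a)\<^sup>2 + (norm b)\<^sup>2"
      using sum_squares_bound[of "norm a" "norm b"] by simp
    moreover have "0 \<le> norm a * norm b" by simp
    ultimately show ?thesis by linarith
  qed
  then show "AE x in cell_measure. norm (f x \<bullet> g x) \<le> norm ((norm (f x))\<^sup>2 + (norm (g x))\<^sup>2)"
    by (auto intro!: AE_I2)
qed

lemma integrable_L2:
  fixes f :: "real^2 \<Rightarrow> 'b::euclidean_space"
  assumes "L2_cell f"
  shows "integrable cell_measure f"
proof (rule Bochner_Integration.integrable_bound)
  interpret finite_measure cell_measure by (rule finite_measure_cell)
  show "integrable cell_measure (\<lambda>x. 1 + (norm (f x))\<^sup>2)"
    using assms by (auto simp: L2_cell_def)
  show "f \<in> borel_measurable cell_measure" using assms by (simp add: L2_cell_def)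
  have "r \<le> 1 + r\<^sup>2" if "0 \<le> r" for r :: real
    using sum_squares_bound[of r 1] that by simp
  then show "AE x in cell_measure. norm (f x) \<le> norm (1 + (norm (f x))\<^sup>2)"
    by (auto intro!: AE_I2)
qed

section \<open>Inequalities, limits and completeness in L^2 of the cell\<close>

lemma L2_integral_add_square:
  fixes f g :: "real^2 \<Rightarrow> 'b::euclidean_space"
  assumes "L2_cell f" "L2_cell g"
  shows "(LINT x|cell_measure. (norm (f x + g x))\<^sup>2) \<le>
    2 * (LINT x|cell_measure. (norm (f x))\<^sup>2) + 2 * (LINT x|cell_measure. (norm (g x))\<^sup>2)"
proof -
  have "(LINT x|cell_measure. (norm (f x + g x))\<^sup>2) \<le>
    (LINT x|cell_measure. 2 * (norm (f x))\<^sup>2 + 2 * (norm (g x))\<^sup>2)"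
    using assms L2_cell_add[OF assms]
    by (intro integral_mono) (auto simp: L2_cell_def norm_add_square_le)
  then show ?thesis using assms by (simp add: L2_cell_def)
qed

lemma L2_integral_diff_square:
  fixes f g h :: "real^2 \<Rightarrow> 'b::euclidean_space"
  assumes "L2_cell f" "L2_cell g" "L2_cell h"
  shows "(LINT x|cell_measure. (norm (f x - g x))\<^sup>2) \<le>
    2 * (LINT x|cell_measure. (norm (f x - h x))\<^sup>2) + 2 * (LINT x|cell_measure. (norm (g x - h x))\<^sup>2)"
  using L2_integral_add_square[OF L2_cell_diff[OF assms(1,3)] L2_cell_diff[OF assms(3,2)]]
  by (simp add: norm_minus_commute)

text \<open>The integral of |s f + t g|^2 is a nonnegative quadratic form in (s, t). Keeping both
  variables lets the degenerate case a = 0 be read off from the same form \<open>q\<close>.\<close>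

lemma L2_Cauchy_Schwarz:
  fixes f g :: "real^2 \<Rightarrow> 'b::euclidean_space"
  assumes f: "L2_cell f" and g: "L2_cell g"
  shows "(LINT x|cell_measure. f x \<bullet> g x)\<^sup>2 \<le>
    (LINT x|cell_measure. (norm (f x))\<^sup>2) * (LINT x|cell_measure. (norm (g x))\<^sup>2)"
proof -
  define a b c where "a = (LINT x|cell_measure. (norm (f x))\<^sup>2)"
    and "b = (LINT x|cell_measure. f x \<bullet> g x)" and "c = (LINT x|cell_measure. (norm (g x))\<^sup>2)"
  have q: "0 \<le> s\<^sup>2 * a + 2 * s * t * b + t\<^sup>2 * c" for s t
  proof -
    have "0 \<le> (LINT x|cell_measure. (norm (s *\<^sub>R f x + t *\<^sub>R g x))\<^sup>2)" by simp
    also have "\<dots> = (LINT x|cell_measure. s\<^sup>2 * (norm (f x))\<^sup>2 + 2 * s * t * (f x \<bullet> g x) + t\<^sup>2 * (norm (g x))\<^sup>2)"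
      by (intro Bochner_Integration.integral_cong)
        (auto simp: power2_norm_eq_inner inner_add inner_commute, simp add: power2_eq_square algebra_simps)
    also have "\<dots> = s\<^sup>2 * a + 2 * s * t * b + t\<^sup>2 * c"
      using f g integrable_L2_inner[OF f g] by (simp add: L2_cell_def a_def b_def c_def)
    finally show ?thesis .
  qed
  have "0 \<le> a" "0 \<le> c" by (simp_all add: a_def c_def)
  have "b\<^sup>2 \<le> a * c"
  proof (cases "a = 0")
    case True
    have "b = 0"
    proof (rule ccontr)
      assume "b \<noteq> 0"
      \<comment> \<open>With a = 0 the form is affine in s at t = 1; this s makes its value
        -1.\<close>
      have "0 \<le> 2 * (- (c + 1) / (2 * b)) * b + c" using q[of "- (c + 1) / (2 * b)" 1] True by simp
      moreover have "2 * (- (c + 1) / (2 * b)) * b = - c - 1" using \<open>b \<noteq> 0\<close> by (simp add: field_simps)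
      ultimately show False by simp
    qed
    then show ?thesis using True by simp
  next
    case False
    \<comment> \<open>At (s, t) = (-b, a) the form factors as a (a c - b^2).\<close>
    have "0 \<le> a * (a * c - b\<^sup>2)" using q[of "-b" a] by (simp add: power2_eq_square algebra_simps)
    then show ?thesis using False \<open>0 \<le> a\<close> by (simp add: zero_le_mult_iff)
  qed
  then show ?thesis by (simp add: a_def b_def c_def)
qed

text \<open>Carries orthogonality relations from smooth approximants to their L^2 limits;
  Cauchy-Schwarz bounds the error.\<close>

lemma L2_inner_tendsto:
  fixes f :: "nat \<Rightarrow> real^2 \<Rightarrow> 'b::euclidean_space"
  assumes f: "\<And>n. L2_cell (f n)" and g: "L2_cell g" and h: "L2_cell h"
    and lim: "(\<lambda>n. LINT x|cell_measure. (norm (f n x - g x))\<^sup>2) \<longlonglongrightarrow> 0"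
  shows "(\<lambda>n. LINT x|cell_measure. f n x \<bullet> h x) \<longlonglongrightarrow> (LINT x|cell_measure. g x \<bullet> h x)"
proof (rule LIM_zero_cancel)
  let ?C = "LINT x|cell_measure. (norm (h x))\<^sup>2"
  have eq: "(LINT x|cell_measure. f n x \<bullet> h x) - (LINT x|cell_measure. g x \<bullet> h x)
      = (LINT x|cell_measure. (f n x - g x) \<bullet> h x)" for n
    by (simp add: inner_diff_left integrable_L2_inner f g h)
  have lim2: "(\<lambda>n. (LINT x|cell_measure. (norm (f n x - g x))\<^sup>2) * ?C) \<longlonglongrightarrow> 0"
    using tendsto_mult_right[OF lim, of ?C] by simp
  have "(\<lambda>n. (LINT x|cell_measure. (f n x - g x) \<bullet> h x)\<^sup>2) \<longlonglongrightarrow> 0"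
    by (rule tendsto_sandwich[OF _ _ tendsto_const lim2])
      (auto intro!: always_eventually L2_Cauchy_Schwarz L2_cell_diff f g h)
  then have "(\<lambda>n. sqrt ((LINT x|cell_measure. (f n x - g x) \<bullet> h x)\<^sup>2)) \<longlonglongrightarrow> sqrt 0"
    by (rule tendsto_real_sqrt)
  then have "(\<lambda>n. LINT x|cell_measure. (f n x - g x) \<bullet> h x) \<longlonglongrightarrow> 0"
    by (simp add: tendsto_rabs_zero_iff)
  then show "(\<lambda>n. (LINT x|cell_measure. f n x \<bullet> h x) - (LINT x|cell_measure. g x \<bullet> h x)) \<longlonglongrightarrow> 0"
    by (simp only: eq)
qed

text \<open>
  The limit is a pointwise limit of a subsequence, so that it inherits everywhere-defined properties
  such as periodicity; where the subsequence diverges \<open>lim\<close> is a junk value, but one that depends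
  only on the sequence of values.
\<close>

lemma L2_complete:
  fixes f :: "nat \<Rightarrow> real^2 \<Rightarrow> 'b::euclidean_space"
  assumes f: "\<And>n. L2_cell (f n)"
    and Cauchy: "\<And>e. e > 0 \<Longrightarrow>
      \<exists>N. \<forall>m\<ge>N. \<forall>n\<ge>N. (LINT x|cell_measure. (norm (f m x - f n x))\<^sup>2) < e"
  obtains r where "L2_cell (\<lambda>x. lim (\<lambda>k. f (r k) x))"
    "(\<lambda>n. LINT x|cell_measure. (norm (f n x - lim (\<lambda>k. f (r k) x)))\<^sup>2) \<longlonglongrightarrow> 0"
proof -
  have [measurable]: "f n \<in> borel_measurable cell_measure" for n using f by (rule L2_cell_measurable)
  define I where "I m n = (LINT x|cell_measure. (norm (f m x - f n x))\<^sup>2)" for m n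
  \<comment> \<open>The rate 1/4 applies to squared norms, so that the increments themselves get the
    summable bound (1/2)^k.\<close>
  have "\<exists>N. \<forall>m\<ge>N. \<forall>n\<ge>N. I m n < (1/4)^k" for k :: nat
    unfolding I_def by (rule Cauchy) simp
  then obtain N where N: "\<And>k m n. m \<ge> N k \<Longrightarrow> n \<ge> N k \<Longrightarrow> I m n < (1/4)^k" by metis
  \<comment> \<open>One formula gives all that is needed of the subsequence: it is monotone and lies
    above both N k and k.\<close>
  define r where "r k = k + (\<Sum>i\<le>k. N i)" for k
  have rN: "N k \<le> r k" for k
    using member_le_sum[of k "{..k}" N] by (simp add: r_def)
  have rmono: "r k \<le> r (Suc k)" for k by (simp add: r_def)
  have rk: "k \<le> r k" for k by (simp add: r_def)
  define g where "g x = lim (\<lambda>k. f (r k) x)" for x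
  have gm[measurable]: "g \<in> borel_measurable cell_measure"
    unfolding g_def by measurable
  define d where "d k x = norm (f (r (Suc k)) x - f (r k) x)" for k x
  have L2d: "L2_cell (\<lambda>x. f (r (Suc k)) x - f (r k) x)" for k
    by (intro L2_cell_diff f)
  have L2d': "L2_cell (d k)" for k
    using L2d[of k] unfolding L2_cell_def d_def by auto
  have intd: "integrable cell_measure (d k)" for k
    by (rule integrable_L2[OF L2d'])
  have dle: "(LINT x|cell_measure. d k x) \<le> (1/2)^k" for k
  proof (rule power2_le_imp_le)
    \<comment> \<open>Cauchy-Schwarz against the constant 1 on a cell of measure 1.\<close>
    have "(LINT x|cell_measure. d k x)\<^sup>2 \<le> (LINT x|cell_measure. (d k x)\<^sup>2)"
      using L2_Cauchy_Schwarz[OF L2d'[of k] L2_cell_const[of "1::real"]] integral_cell_const[of "1::real"]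
      by simp
    also have "\<dots> = I (r (Suc k)) (r k)" by (simp add: d_def I_def)
    also have "\<dots> \<le> (1/4)^k" using N[of k "r (Suc k)" "r k"] rN rmono by (meson less_imp_le order_trans)
    also have "\<dots> = ((1/2)^k)\<^sup>2" by (simp add: power_even_eq[symmetric] power_mult power2_eq_square flip: power_mult_distrib)
    finally show "(LINT x|cell_measure. d k x)\<^sup>2 \<le> ((1/2)^k)\<^sup>2" .
  qed simp
  \<comment> \<open>The increments have finite total integral, so almost everywhere the telescoping
    series converges absolutely.\<close>
  have "(\<integral>\<^sup>+x. (\<Sum>k. ennreal (d k x)) \<partial>cell_measure) = (\<Sum>k. \<integral>\<^sup>+x. ennreal (d k x) \<partial>cell_measure)"
    using intd by (intro nn_integral_suminf) auto
  also have "\<dots> \<le> (\<Sum>k. ennreal ((1/2)^k))"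
  proof (intro suminf_le)
    have "0 \<le> d k x" for k x by (simp add: d_def)
    then show "(\<integral>\<^sup>+x. ennreal (d k x) \<partial>cell_measure) \<le> ennreal ((1/2)^k)" for k
      using dle by (simp add: nn_integral_eq_integral[OF intd] ennreal_leI)
  qed auto
  also have "\<dots> = ennreal (\<Sum>k. (1/2)^k)"
    by (intro suminf_ennreal2) (auto intro!: summable_geometric)
  also have "\<dots> < \<infinity>" by simp
  finally have "AE x in cell_measure. (\<Sum>k. ennreal (d k x)) \<noteq> \<infinity>"
    using intd by (intro nn_integral_PInf_AE) auto
  then have conv: "AE x in cell_measure. (\<lambda>k. f (r k) x) \<longlonglongrightarrow> g x"
  proof eventually_elim
    case (elim x)
    have "summable (\<lambda>k. d k x)"
      by (rule summable_suminf_not_top) (use elim in \<open>auto simp: d_def\<close>)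
    then have "summable (\<lambda>k. f (r (Suc k)) x - f (r k) x)"
      unfolding d_def by (rule summable_norm_cancel)
    then have "convergent (\<lambda>n. \<Sum>k<n. f (r (Suc k)) x - f (r k) x)"
      by (simp add: summable_iff_convergent)
    then have "convergent (\<lambda>n. f (r n) x - f (r 0) x)"
      by (simp add: sum_lessThan_telescope[of "\<lambda>k. f (r k) x"])
    then have "convergent (\<lambda>n. f (r n) x)"
      by (metis convergent_diff_const_right_iff)
    then show ?case by (simp add: g_def convergent_LIMSEQ_iff)
  qed
  \<comment> \<open>Fatou\<close>
  have bound: "(\<integral>\<^sup>+x. ennreal ((norm (f n x - g x))\<^sup>2) \<partial>cell_measure) \<le> ennreal e"
    if "\<forall>m\<ge>M. \<forall>n\<ge>M. I m n < e" "n \<ge> M" for n e M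
  proof -
    have "(\<integral>\<^sup>+x. ennreal ((norm (f n x - g x))\<^sup>2) \<partial>cell_measure)
      = (\<integral>\<^sup>+x. liminf (\<lambda>k. ennreal ((norm (f n x - f (r k) x))\<^sup>2)) \<partial>cell_measure)"
    proof (rule nn_integral_cong_AE)
      show "AE x in cell_measure. ennreal ((norm (f n x - g x))\<^sup>2)
          = liminf (\<lambda>k. ennreal ((norm (f n x - f (r k) x))\<^sup>2))"
        using conv
      proof eventually_elim
        case (elim x)
        then have "(\<lambda>k. ennreal ((norm (f n x - f (r k) x))\<^sup>2)) \<longlonglongrightarrow> ennreal ((norm (f n x - g x))\<^sup>2)"
          by (intro tendsto_ennrealI tendsto_intros)
        then show ?case by (rule lim_imp_Liminf[symmetric, rotated]) simp
      qed
    qed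
    also have "\<dots> \<le> liminf (\<lambda>k. \<integral>\<^sup>+x. ennreal ((norm (f n x - f (r k) x))\<^sup>2) \<partial>cell_measure)"
      by (rule nn_integral_liminf) auto
    also have "\<dots> \<le> limsup (\<lambda>k. \<integral>\<^sup>+x. ennreal ((norm (f n x - f (r k) x))\<^sup>2) \<partial>cell_measure)"
      by (rule Liminf_le_Limsup) simp
    also have "\<dots> \<le> ennreal e"
    proof (rule Limsup_bounded, rule eventually_sequentiallyI)
      fix k assume "M \<le> k"
      have "integrable cell_measure (\<lambda>x. (norm (f n x - f (r k) x))\<^sup>2)"
        using L2_cell_diff[OF f f, of n "r k"] by (simp add: L2_cell_def)
      then have "(\<integral>\<^sup>+x. ennreal ((norm (f n x - f (r k) x))\<^sup>2) \<partial>cell_measure) = ennreal (I n (r k))"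
        unfolding I_def by (intro nn_integral_eq_integral) auto
      also have "\<dots> \<le> ennreal e"
        using that \<open>M \<le> k\<close> rk[of k] by (intro ennreal_leI) (meson less_imp_le order_trans)
      finally show "(\<integral>\<^sup>+x. ennreal ((norm (f n x - f (r k) x))\<^sup>2) \<partial>cell_measure) \<le> ennreal e" .
    qed
    finally show ?thesis .
  qed
  have L2diff: "L2_cell (\<lambda>x. f n x - g x) \<and> (LINT x|cell_measure. (norm (f n x - g x))\<^sup>2) \<le> e"
    if "\<forall>m\<ge>M. \<forall>n\<ge>M. I m n < e" "n \<ge> M" "e > 0" for n e M
  proof
    have "(\<integral>\<^sup>+x. ennreal ((norm (f n x - g x))\<^sup>2) \<partial>cell_measure) < \<infinity>"
      using bound[OF that(1,2)] by (simp add: order_le_less_trans)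
    then have int: "integrable cell_measure (\<lambda>x. (norm (f n x - g x))\<^sup>2)"
      by (intro integrableI_nonneg) auto
    then show "L2_cell (\<lambda>x. f n x - g x)" by (simp add: L2_cell_def)
    have "ennreal (LINT x|cell_measure. (norm (f n x - g x))\<^sup>2) \<le> ennreal e"
      using bound[OF that(1,2)] nn_integral_eq_integral[OF int] by simp
    then show "(LINT x|cell_measure. (norm (f n x - g x))\<^sup>2) \<le> e"
      using that(3) by (simp add: ennreal_le_iff)
  qed
  obtain M where M: "\<forall>m\<ge>M. \<forall>n\<ge>M. I m n < 1" using Cauchy[of 1] by (auto simp: I_def)
  have "L2_cell g"
    using L2_cell_diff[OF f[of M] conjunct1[OF L2diff[OF M, of M]]] by simp
  moreover have "(\<lambda>n. LINT x|cell_measure. (norm (f n x - g x))\<^sup>2) \<longlonglongrightarrow> 0"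
  proof (rule LIMSEQ_I)
    fix e :: real assume "e > 0"
    then obtain M where M: "\<forall>m\<ge>M. \<forall>n\<ge>M. I m n < e/2" using Cauchy[of "e/2"] by (auto simp: I_def)
    have "norm ((LINT x|cell_measure. (norm (f n x - g x))\<^sup>2) - 0) < e" if "n \<ge> M" for n
      using L2diff[OF M that] \<open>e > 0\<close> by simp
    then show "\<exists>M. \<forall>n\<ge>M. norm ((LINT x|cell_measure. (norm (f n x - g x))\<^sup>2) - 0) < e" by blast
  qed
  ultimately show thesis using that[of r] by (simp add: g_def[abs_def])
qed

section \<open>Iterated integrals, integration by parts and the Poincare inequality\<close>

lemma vector_2_eq_axis: "(vector [a, b] :: real^2) = a *\<^sub>R axis 1 1 + b *\<^sub>R axis 2 1"
  by (simp add: vec_eq_iff forall_2 axis_def)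

lemma continuous_vector_2 [continuous_intros]:
  fixes f g :: "'a::topological_space \<Rightarrow> real"
  assumes "continuous_on S f" "continuous_on S g"
  shows "continuous_on S (\<lambda>x. vector [f x, g x] :: real^2)"
  unfolding vector_2_eq_axis by (intro continuous_intros assms)

lemma prod_Basis_2:
  fixes f :: "real^2 \<Rightarrow> 'b::comm_monoid_mult"
  shows "(\<Prod>b\<in>Basis. f b) = f (axis 1 1) * f (axis 2 1)"
proof -
  have "(Basis :: (real^2) set) = range (\<lambda>i. axis i 1)" by (auto simp: Basis_vec_def)
  then have eq: "(Basis :: (real^2) set) = {axis 1 1, axis 2 1}" by (simp add: UNIV_2)
  have "(axis 1 1 :: real^2) \<noteq> axis 2 1" by (simp add: axis_eq_axis)
  then show ?thesis unfolding eq by simp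
qed

text \<open>Transports iterated integration from pairs to \<open>real^2\<close>; agreement on boxes
  determines the measure.\<close>

lemma lborel_vector_2:
  "distr (lborel :: (real \<times> real) measure) borel (\<lambda>p. vector [fst p, snd p]) = (lborel :: (real^2) measure)"
proof (rule lborel_eqI[symmetric])
  have meas: "(\<lambda>p::real\<times>real. vector [fst p, snd p] :: real^2) \<in> borel_measurable lborel"
    by (simp, intro borel_measurable_continuous_onI continuous_intros)
  fix l u :: "real^2" assume lu: "\<And>b. b \<in> Basis \<Longrightarrow> l \<bullet> b \<le> u \<bullet> b"
  have le: "l $ i \<le> u $ i" for i
    using lu[of "axis i 1"] by (simp add: inner_axis)
  have eq: "(\<lambda>p. vector [fst p, snd p]) -` box l u = box (l $ 1) (u $ 1) \<times> box (l $ 2) (u $ 2)"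
    by (auto simp: mem_box_cart forall_2)
  have "emeasure (distr lborel borel (\<lambda>p::real\<times>real. vector [fst p, snd p])) (box l u)
      = emeasure (lborel \<Otimes>\<^sub>M lborel) (box (l $ 1) (u $ 1) \<times> box (l $ 2) (u $ 2))"
    using meas by (simp add: emeasure_distr eq lborel_prod)
  also have "\<dots> = ennreal (u $ 1 - l $ 1) * ennreal (u $ 2 - l $ 2)"
    by (subst lborel.emeasure_pair_measure_Times) (simp_all add: le emeasure_lborel_box_eq)
  also have "\<dots> = ennreal (\<Prod>b\<in>Basis. (u - l) \<bullet> b)"
    by (simp add: prod_Basis_2 inner_axis ennreal_mult le)
  finally show "emeasure (distr lborel borel (\<lambda>p::real\<times>real. vector [fst p, snd p])) (box l u)
      = ennreal (\<Prod>b\<in>Basis. (u - l) \<bullet> b)" by simp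
qed simp

text \<open>Both orders are recorded because a partial derivative is integrated away only when its
  own variable is innermost.\<close>

lemma integral_cell_eq_iterated:
  fixes f :: "real^2 \<Rightarrow> real"
  assumes f: "continuous_on UNIV f"
  shows "(LINT x|cell_measure. f x) = integral {0..1} (\<lambda>a. integral {0..1} (\<lambda>b. f (vector [a, b])))"
    and "(LINT x|cell_measure. f x) = integral {0..1} (\<lambda>b. integral {0..1} (\<lambda>a. f (vector [a, b])))"
proof -
  let ?v = "\<lambda>p::real\<times>real. vector [fst p, snd p] :: real^2"
  have fm: "f \<in> borel_measurable borel" using f by (rule borel_measurable_continuous_onI)
  have vm: "?v \<in> borel_measurable lborel"
    by (simp, intro borel_measurable_continuous_onI continuous_intros)
  have cv: "continuous_on S (\<lambda>p. f (?v p))" for S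
    by (rule continuous_on_compose2[OF f]) (auto intro!: continuous_intros)
  have cv2: "continuous_on S (\<lambda>(a, b). f (vector [a, b]))" for S
    using cv[of S] by (simp add: case_prod_unfold)
  have ind: "?v p \<in> cbox 0 1 \<longleftrightarrow> p \<in> cbox (0,0) (1,1)" for p
    by (cases p) (auto simp: mem_box_cart forall_2)
  have "(LINT x|cell_measure. f x) = (LINT x|lebesgue. indicator (cbox 0 1) x *\<^sub>R f x)"
    by (rule integral_restrict_space) auto
  also have "\<dots> = (LINT x|lborel. indicator (cbox 0 1) x *\<^sub>R f x)"
    by (rule integral_completion) (use fm in measurable)
  also have "\<dots> = (LINT x|distr lborel borel ?v. indicator (cbox 0 1) x *\<^sub>R f x)"
    by (simp add: lborel_vector_2)
  also have "\<dots> = (LINT p|lborel. indicator (cbox 0 1) (?v p) *\<^sub>R f (?v p))"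
    by (rule integral_distr) (use vm fm in measurable)
  also have "\<dots> = (LINT p:cbox (0,0) (1,1)|lborel. f (?v p))"
    unfolding set_lebesgue_integral_def
    by (intro Bochner_Integration.integral_cong) (auto simp: indicator_def ind)
  also have "\<dots> = integral (cbox (0,0) (1,1)) (\<lambda>p. f (?v p))"
    by (rule set_borel_integral_eq_integral, unfold set_integrable_def, rule borel_integrable_compact)
      (auto intro: cv)
  also have "\<dots> = integral (cbox 0 1) (\<lambda>a. integral (cbox 0 1) (\<lambda>b. f (?v (a, b))))"
    by (rule integral_prod_continuous[OF cv])
  finally have 1: "(LINT x|cell_measure. f x) =
      integral (cbox 0 1) (\<lambda>a. integral (cbox 0 1) (\<lambda>b. f (vector [a, b])))" by simp
  then show "(LINT x|cell_measure. f x) = integral {0..1} (\<lambda>a. integral {0..1} (\<lambda>b. f (vector [a, b])))"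
    by (simp add: cbox_interval)
  show "(LINT x|cell_measure. f x) = integral {0..1} (\<lambda>b. integral {0..1} (\<lambda>a. f (vector [a, b])))"
    using 1 integral_swap_continuous[OF cv2, of 0 1 0 1] by (simp add: cbox_interval)
qed

lemma vector_2_has_derivative:
  fixes h :: "real^2 \<Rightarrow> real"
  assumes "\<And>x. (h has_derivative (\<lambda>v. h' x \<bullet> v)) (at x)"
  shows "((\<lambda>a. h (vector [a, b])) has_real_derivative h' (vector [a, b]) $ 1) (at a within S)"
    and "((\<lambda>b. h (vector [a, b])) has_real_derivative h' (vector [a, b]) $ 2) (at b within S)"
proof -
  have "((\<lambda>a. vector [a, b] :: real^2) has_derivative (\<lambda>t. t *\<^sub>R axis 1 1)) (at a within S)"
    unfolding vector_2_eq_axis by (auto intro!: derivative_eq_intros)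
  from diff_chain_within[OF this has_derivative_at_withinI[OF assms]]
  show "((\<lambda>a. h (vector [a, b])) has_real_derivative h' (vector [a, b]) $ 1) (at a within S)"
    by (simp add: o_def inner_axis has_field_derivative_def mult_commute_abs)
  have "((\<lambda>b. vector [a, b] :: real^2) has_derivative (\<lambda>t. t *\<^sub>R axis 2 1)) (at b within S)"
    unfolding vector_2_eq_axis by (auto intro!: derivative_eq_intros)
  from diff_chain_within[OF this has_derivative_at_withinI[OF assms]]
  show "((\<lambda>b. h (vector [a, b])) has_real_derivative h' (vector [a, b]) $ 2) (at b within S)"
    by (simp add: o_def inner_axis has_field_derivative_def mult_commute_abs)
qed

text \<open>On each line in direction i the inner integral is a difference of endpoint values, which
  periodicity makes equal. All integrations by parts rest on this.\<close>

lemma integral_cell_derivative_periodic: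
  fixes h :: "real^2 \<Rightarrow> real"
  assumes h: "\<And>x. (h has_derivative (\<lambda>v. h' x \<bullet> v)) (at x)"
    and cont: "continuous_on UNIV h'" and per: "cell_periodic h"
  shows "(LINT x|cell_measure. h' x $ i) = 0"
proof -
  have c: "continuous_on UNIV (\<lambda>x. h' x $ i)" for i by (intro continuous_intros cont)
  have p1: "h (vector [1, b]) = h (vector [0, b])" for b
  proof -
    have "vector [0, b] + axis 1 1 = (vector [1, b] :: real^2)" by (simp add: vector_2_eq_axis)
    then show ?thesis using per unfolding cell_periodic_def by metis
  qed
  have p2: "h (vector [a, 1]) = h (vector [a, 0])" for a
  proof -
    have "vector [a, 0] + axis 2 1 = (vector [a, 1] :: real^2)" by (simp add: vector_2_eq_axis)
    then show ?thesis using per unfolding cell_periodic_def by metis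
  qed
  have "integral {0..1} (\<lambda>a. h' (vector [a, b]) $ 1) = 0" for b
    using fundamental_theorem_of_calculus[OF _ vector_2_has_derivative(1)[OF h, unfolded has_real_derivative_iff_has_vector_derivative], of 0 1 b]
    by (auto simp: p1 intro: integral_unique)
  then have "(LINT x|cell_measure. h' x $ 1) = 0"
    by (simp add: integral_cell_eq_iterated(2)[OF c])
  moreover have "integral {0..1} (\<lambda>b. h' (vector [a, b]) $ 2) = 0" for a
    using fundamental_theorem_of_calculus[OF _ vector_2_has_derivative(2)[OF h, unfolded has_real_derivative_iff_has_vector_derivative], of 0 1 a]
    by (auto simp: p2 intro: integral_unique)
  then have "(LINT x|cell_measure. h' x $ 2) = 0"
    by (simp add: integral_cell_eq_iterated(1)[OF c])
  ultimately show ?thesis using exhaust_2[of i] by auto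
qed

text \<open>With D the increment of v, integrate 2 D v' - D^2 \<le> (v')^2 over the interval between
  the two points. Its length is at most 1, so the left side integrates to at least D^2.\<close>

lemma interval_oscillation_bound:
  fixes v v' :: "real \<Rightarrow> real"
  assumes v: "\<And>t. (v has_real_derivative v' t) (at t)" and cont: "continuous_on UNIV v'"
    and s: "s \<in> {0..1}" and t: "t \<in> {0..1}"
  shows "(v s - v t)\<^sup>2 \<le> integral {0..1} (\<lambda>r. (v' r)\<^sup>2)"
proof -
  have *: "(v s - v t)\<^sup>2 \<le> integral {0..1} (\<lambda>r. (v' r)\<^sup>2)"
    if "t \<le> s" "s \<in> {0..1}" "t \<in> {0..1}" for s t
  proof -
    define D where "D = v s - v t"
    have c': "continuous_on S v'" for S using cont continuous_on_subset by blast
    have "(v' has_integral D) {t..s}"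
      unfolding D_def using that v
      by (intro fundamental_theorem_of_calculus)
        (auto simp: has_real_derivative_iff_has_vector_derivative[symmetric] intro: has_field_derivative_at_within)
    then have "((\<lambda>r. 2 * D * v' r - D\<^sup>2) has_integral (2 * D * D - D\<^sup>2 * (s - t))) {t..s}"
      using has_integral_diff[OF has_integral_mult_right has_integral_const_real[of "D\<^sup>2" t s], of v' D "2 * D"] that
      by (simp add: mult.commute)
    moreover have "2 * D * v' r - D\<^sup>2 \<le> (v' r)\<^sup>2" for r
      using sum_squares_bound[of D "v' r"] by simp \<comment> \<open>Cauchy-Schwarz via AM-GM\<close>
    ultimately have "2 * D * D - D\<^sup>2 * (s - t) \<le> integral {t..s} (\<lambda>r. (v' r)\<^sup>2)"
      by (intro has_integral_le[OF _ integrable_integral])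
        (auto intro!: integrable_continuous_real continuous_intros c')
    also have "\<dots> \<le> integral {0..1} (\<lambda>r. (v' r)\<^sup>2)"
      using that by (intro integral_subset_le) (auto intro!: integrable_continuous_real continuous_intros c')
    finally have "2 * D * D - D\<^sup>2 * (s - t) \<le> integral {0..1} (\<lambda>r. (v' r)\<^sup>2)" .
    moreover have "D\<^sup>2 * (s - t) \<le> D\<^sup>2 * 1" using that by (intro mult_left_mono) auto
    moreover have "2 * D * D = 2 * D\<^sup>2" by (simp add: power2_eq_square)
    ultimately show ?thesis unfolding D_def by linarith
  qed
  show ?thesis
  proof (cases "t \<le> s")
    case False
    then show ?thesis using *[of s t] s t by (simp add: power2_commute)
  qed (use * s t in blast)
qed

text \<open>The constant 1 arises by cancellation: the squared triangle inequality costs a factor 2,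
  and integrating (u x - u y)^2 over both points yields two copies of the integral of u^2.\<close>

lemma poincare_cell:
  fixes u :: "real^2 \<Rightarrow> real"
  assumes u: "\<And>x. (u has_derivative (\<lambda>v. u' x \<bullet> v)) (at x)"
    and cont: "continuous_on UNIV u'" and mean: "(LINT x|cell_measure. u x) = 0"
  shows "(LINT x|cell_measure. (u x)\<^sup>2) \<le> (LINT x|cell_measure. (norm (u' x))\<^sup>2)"
proof -
  have cu: "continuous_on UNIV u"
    using u by (intro continuous_at_imp_continuous_on ballI) (metis has_derivative_continuous)
  have cv: "continuous_on UNIV (\<lambda>t. u' (vector [a, t]) $ i)" "continuous_on UNIV (\<lambda>t. u' (vector [t, b]) $ i)" for i a b
    by (auto intro!: continuous_intros continuous_on_compose2[OF cont])
  \<comment> \<open>A1 and A2 are the energies along the horizontal segment at height b and the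
    vertical segment at abscissa a.\<close>
  define A1 where "A1 b = integral {0..1} (\<lambda>t. (u' (vector [t, b]) $ 1)\<^sup>2)" for b
  define A2 where "A2 a = integral {0..1} (\<lambda>t. (u' (vector [a, t]) $ 2)\<^sup>2)" for a
  have cA1: "continuous_on UNIV A1"
    unfolding A1_def cbox_interval[symmetric]
    by (rule integral_continuous_on_param)
      (auto intro!: continuous_intros continuous_on_compose2[OF cont] simp: case_prod_unfold)
  have cA2: "continuous_on UNIV A2"
    unfolding A2_def cbox_interval[symmetric]
    by (rule integral_continuous_on_param)
      (auto intro!: continuous_intros continuous_on_compose2[OF cont] simp: case_prod_unfold)
  have cA1': "continuous_on UNIV (\<lambda>x::real^2. A1 (x $ 2))" "continuous_on UNIV (\<lambda>x::real^2. A2 (x $ 1))"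
    by (auto intro!: continuous_intros continuous_on_compose2[OF cA1] continuous_on_compose2[OF cA2])
  have cd: "continuous_on UNIV (\<lambda>x. (u' x $ i)\<^sup>2)" for i
    by (intro continuous_intros cont)
  have IA1: "(LINT x|cell_measure. A1 (x $ 2)) = (LINT x|cell_measure. (u' x $ 1)\<^sup>2)"
    unfolding integral_cell_eq_iterated(2)[OF cA1'(1)] integral_cell_eq_iterated(2)[OF cd] by (simp add: A1_def)
  have IA2: "(LINT x|cell_measure. A2 (x $ 1)) = (LINT x|cell_measure. (u' x $ 2)\<^sup>2)"
    unfolding integral_cell_eq_iterated(1)[OF cA1'(2)] integral_cell_eq_iterated(1)[OF cd] by (simp add: A2_def)
  have vec: "vector [x $ 1, x $ 2] = x" for x :: "real^2" by (simp add: vec_eq_iff forall_2)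
  \<comment> \<open>Join \<open>x\<close> to \<open>y\<close> through the corner \<open>(y\<^sub>1, x\<^sub>2)\<close>; integrating over both points gives the claim,
    because the mixed term vanishes for mean zero.\<close>
  have ptw: "(u x - u y)\<^sup>2 \<le> 2 * A1 (x $ 2) + 2 * A2 (y $ 1)" if "x \<in> cbox 0 1" "y \<in> cbox 0 1" for x y
  proof -
    have i: "0 \<le> x $ i" "x $ i \<le> 1" "0 \<le> y $ i" "y $ i \<le> 1" for i using that by (auto simp: mem_box_cart)
    have "(u (vector [x $ 1, x $ 2]) - u (vector [y $ 1, x $ 2]))\<^sup>2 \<le> A1 (x $ 2)"
      unfolding A1_def
      by (rule interval_oscillation_bound[OF vector_2_has_derivative(1)[OF u]]) (auto intro!: cv i)
    moreover have "(u (vector [y $ 1, x $ 2]) - u (vector [y $ 1, y $ 2]))\<^sup>2 \<le> A2 (y $ 1)"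
      unfolding A2_def
      by (rule interval_oscillation_bound[OF vector_2_has_derivative(2)[OF u]]) (auto intro!: cv i)
    ultimately show ?thesis
      using norm_add_square_le[of "u x - u (vector [y $ 1, x $ 2])" "u (vector [y $ 1, x $ 2]) - u y"]
      by (simp add: vec)
  qed
  note icell = integrable_cell_continuous
  have iu: "integrable cell_measure u" "integrable cell_measure (\<lambda>x. (u x)\<^sup>2)"
    by (auto intro!: icell continuous_intros cu)
  have fm: "integrable cell_measure (\<lambda>x. c)" for c :: real
    by (rule icell) simp
  have one: "(u x)\<^sup>2 + (LINT y|cell_measure. (u y)\<^sup>2) \<le> 2 * A1 (x $ 2) + 2 * (LINT y|cell_measure. (u' y $ 2)\<^sup>2)"
    if x: "x \<in> cbox 0 1" for x
  proof -
    have "(LINT y|cell_measure. (u x)\<^sup>2 - 2 * u x * u y + (u y)\<^sup>2) \<le> (LINT y|cell_measure. 2 * A1 (x $ 2) + 2 * A2 (y $ 1))"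
    proof (rule integral_mono)
      fix y assume "y \<in> space cell_measure"
      then show "(u x)\<^sup>2 - 2 * u x * u y + (u y)\<^sup>2 \<le> 2 * A1 (x $ 2) + 2 * A2 (y $ 1)"
        using ptw[OF x, of y] by (simp add: power2_diff space_restrict_space)
    qed (auto intro!: icell continuous_intros cu cA1')
    moreover have "(LINT y|cell_measure. (u x)\<^sup>2 - 2 * u x * u y + (u y)\<^sup>2) = (u x)\<^sup>2 + (LINT y|cell_measure. (u y)\<^sup>2)"
      using iu fm mean by (simp add: integral_cell_const del: lebesgue_integral_const)
    moreover have "(LINT y|cell_measure. 2 * A1 (x $ 2) + 2 * A2 (y $ 1)) = 2 * A1 (x $ 2) + 2 * (LINT y|cell_measure. (u' y $ 2)\<^sup>2)"
      using fm icell[OF cA1'(2)] by (simp add: integral_cell_const IA2 del: lebesgue_integral_const)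
    ultimately show ?thesis by simp
  qed
  have "(LINT x|cell_measure. (u x)\<^sup>2 + (LINT y|cell_measure. (u y)\<^sup>2))
      \<le> (LINT x|cell_measure. 2 * A1 (x $ 2) + 2 * (LINT y|cell_measure. (u' y $ 2)\<^sup>2))"
    by (rule integral_mono) (auto intro!: icell continuous_intros cu cA1' one simp: space_restrict_space)
  then have "2 * (LINT x|cell_measure. (u x)\<^sup>2) \<le> 2 * (LINT x|cell_measure. (u' x $ 1)\<^sup>2) + 2 * (LINT x|cell_measure. (u' x $ 2)\<^sup>2)"
    using iu fm icell[OF cA1'(1)] by (simp add: integral_cell_const IA1 del: lebesgue_integral_const)
  also have "\<dots> = 2 * (LINT x|cell_measure. (norm (u' x))\<^sup>2)"
    by (simp add: power2_norm_eq_inner inner_vec_def sum_2 flip: power2_eq_square)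
      (subst Bochner_Integration.integral_add, auto intro!: icell continuous_intros cont)
  finally show ?thesis by simp
qed

section \<open>Trigonometric polynomials\<close>

text \<open>The free phase covers sines as well as cosines, so that products and derivatives stay
  within one real family; a derivative is a phase shift by pi/2 times a factor.\<close>

definition wave :: "(2 \<Rightarrow> int) \<Rightarrow> real \<Rightarrow> real^2 \<Rightarrow> real" where
  "wave k \<theta> x = cos (2 * pi * (\<Sum>i\<in>UNIV. of_int (k i) * x $ i) + \<theta>)"

inductive trig_poly :: "(real^2 \<Rightarrow> real) \<Rightarrow> bool" where
  wave: "trig_poly (\<lambda>x. a * wave k \<theta> x)"
| add: "trig_poly f \<Longrightarrow> trig_poly g \<Longrightarrow> trig_poly (\<lambda>x. f x + g x)"

lemma trig_poly_const: "trig_poly (\<lambda>x. c)"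
proof -
  have "(\<lambda>x. c * wave (\<lambda>_. 0) 0 x) = (\<lambda>x. c)" by (simp add: wave_def)
  then show ?thesis using trig_poly.wave[of c "\<lambda>_. 0" 0] by simp
qed

lemma trig_poly_cmult: "trig_poly f \<Longrightarrow> trig_poly (\<lambda>x. c * f x)"
proof (induction rule: trig_poly.induct)
  case (wave a k \<theta>)
  then show ?case using trig_poly.wave[of "c * a" k \<theta>] by (simp add: mult.assoc)
next
  case (add f g)
  then show ?case using trig_poly.add by (simp add: distrib_left)
qed

lemma trig_poly_minus: "trig_poly f \<Longrightarrow> trig_poly (\<lambda>x. - f x)"
  using trig_poly_cmult[of f "-1"] by simp

lemma trig_poly_diff: "trig_poly f \<Longrightarrow> trig_poly g \<Longrightarrow> trig_poly (\<lambda>x. f x - g x)"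
  using trig_poly.add[OF _ trig_poly_minus, of f g] by simp

text \<open>Product-to-sum formula. Integer frequencies stay integer, which makes the trigonometric
  polynomials an algebra.\<close>

lemma wave_mult_wave:
  "wave k \<theta> x * wave l \<eta> x = 1/2 * wave (\<lambda>i. k i - l i) (\<theta> - \<eta>) x + 1/2 * wave (\<lambda>i. k i + l i) (\<theta> + \<eta>) x"
proof -
  define s t where "s = (\<Sum>i\<in>UNIV. of_int (k i) * x $ i)" and "t = (\<Sum>i\<in>UNIV. of_int (l i) * x $ i)"
  have sums: "(\<Sum>i\<in>UNIV. of_int (k i - l i) * x $ i) = s - t" "(\<Sum>i\<in>UNIV. of_int (k i + l i) * x $ i) = s + t"
    by (simp_all add: s_def t_def algebra_simps sum.distrib sum_subtractf)
  show ?thesis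
    unfolding wave_def sums s_def[symmetric] t_def[symmetric]
    using cos_times_cos[of "2 * pi * s + \<theta>" "2 * pi * t + \<eta>"]
    by (simp add: algebra_simps add_divide_distrib)
qed

lemma trig_poly_mult:
  assumes "trig_poly f" "trig_poly g"
  shows "trig_poly (\<lambda>x. f x * g x)"
  using assms
proof (induction rule: trig_poly.induct)
  case (wave a k \<theta>)
  from wave show ?case
  proof (induction rule: trig_poly.induct)
    case (wave b l \<eta>)
    have eq: "(\<lambda>x. a * wave k \<theta> x * (b * wave l \<eta> x)) =
      (\<lambda>x. (a * b / 2) * wave (\<lambda>i. k i - l i) (\<theta> - \<eta>) x + (a * b / 2) * wave (\<lambda>i. k i + l i) (\<theta> + \<eta>) x)"
    proof
      fix x
      have "a * wave k \<theta> x * (b * wave l \<eta> x) = a * b * (wave k \<theta> x * wave l \<eta> x)" by simp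
      then show "a * wave k \<theta> x * (b * wave l \<eta> x) = (a * b / 2) * wave (\<lambda>i. k i - l i) (\<theta> - \<eta>) x + (a * b / 2) * wave (\<lambda>i. k i + l i) (\<theta> + \<eta>) x"
        by (simp add: wave_mult_wave distrib_left)
    qed
    show ?case unfolding eq by (intro trig_poly.intros)
  next
    case (add f g)
    then show ?case using trig_poly.add by (simp add: distrib_left)
  qed
next
  case (add f g)
  then show ?case using trig_poly.add by (simp add: distrib_right)
qed

section \<open>Derivatives, smoothness and periodicity of trigonometric polynomials\<close>

definition pd :: "2 \<Rightarrow> (real^2 \<Rightarrow> real) \<Rightarrow> real^2 \<Rightarrow> real" where
  "pd i f x = grad f x $ i"

lemma grad_eqI:
  assumes "(f has_derivative (\<lambda>h. g \<bullet> h)) (at x)"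
  shows "grad f x = g"
  using frechet_derivative_at[OF assms, symmetric] by (simp add: grad_def vec_eq_iff inner_axis)

lemma wave_has_derivative:
  "((\<lambda>x. a * wave k \<theta> x) has_derivative
    (\<lambda>h. \<Sum>i\<in>UNIV. (a * (2 * pi * k i)) * wave k (\<theta> + pi/2) x * h $ i)) (at x)"
proof -
  define s where "s x = 2 * pi * (\<Sum>i\<in>UNIV. of_int (k i) * x $ i)" for x :: "real^2"
  have "bounded_linear s"
    unfolding s_def by (intro bounded_linear_const_mult bounded_linear_sum bounded_linear_vec_nth)
  then have "(s has_derivative s) (at x)" by (rule bounded_linear_imp_has_derivative)
  then have "((\<lambda>x. a * cos (s x + \<theta>)) has_derivative (\<lambda>h. a * (s h * - sin (s x + \<theta>)))) (at x)"
    by (auto intro!: derivative_eq_intros)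
  moreover have "a * (s h * - sin (s x + \<theta>)) = (\<Sum>i\<in>UNIV. (a * (2 * pi * k i)) * wave k (\<theta> + pi/2) x * h $ i)" for h
  proof -
    have "wave k (\<theta> + pi/2) x = cos ((s x + \<theta>) + pi/2)" by (simp add: wave_def s_def add.assoc)
    also have "\<dots> = - sin (s x + \<theta>)" by (simp add: cos_add)
    finally show ?thesis
      by (simp add: s_def sum_distrib_left sum_distrib_right sum_negf mult_ac)
  qed
  ultimately show ?thesis by (simp add: wave_def s_def)
qed

lemma smooth_wave: "smooth (\<lambda>x. a * wave k \<theta> x)"
  unfolding smooth_def
proof (intro exI conjI allI)
  \<comment> \<open>Every derivative shifts the phase by \<open>\<pi>/2\<close>.\<close>
  define D where "D is x = (a * (\<Prod>i\<leftarrow>is. 2 * pi * k i)) * wave k (\<theta> + length is * (pi/2)) x" for "is" x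
  show "D [] = (\<lambda>x. a * wave k \<theta> x)" by (simp add: D_def fun_eq_iff)
  show "(D is has_derivative (\<lambda>h. \<Sum>i\<in>UNIV. D (i # is) x * h $ i)) (at x)" for "is" x
    using wave_has_derivative[of "a * (\<Prod>i\<leftarrow>is. 2 * pi * k i)" k "\<theta> + length is * (pi/2)" x]
    by (simp add: D_def[abs_def] algebra_simps add_divide_distrib)
qed

lemma smooth_add:
  assumes "smooth f" "smooth g"
  shows "smooth (\<lambda>x. f x + g x)"
proof -
  obtain D where D: "D [] = f"
    "\<And>is x. (D is has_derivative (\<lambda>h. \<Sum>i\<in>UNIV. D (i # is) x * h $ i)) (at x)"
    using assms(1) unfolding smooth_def by blast
  obtain D' where D': "D' [] = g"
    "\<And>is x. (D' is has_derivative (\<lambda>h. \<Sum>i\<in>UNIV. D' (i # is) x * h $ i)) (at x)"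
    using assms(2) unfolding smooth_def by blast
  show ?thesis
    unfolding smooth_def
    by (intro exI[of _ "\<lambda>is x. D is x + D' is x"])
      (auto simp: D(1) D'(1) distrib_right sum.distrib intro!: has_derivative_eq_rhs[OF has_derivative_add[OF D(2) D'(2)]])
qed

lemma cell_periodic_wave: "cell_periodic (\<lambda>x. a * wave k \<theta> x)"
  unfolding cell_periodic_def
proof (intro allI)
  fix x :: "real^2" and i :: 2
  have "(\<Sum>j\<in>UNIV. of_int (k j) * (x + axis i 1) $ j) = (\<Sum>j\<in>UNIV. of_int (k j) * x $ j) + (\<Sum>j\<in>UNIV. of_int (k j) * axis i 1 $ j)"
    by (simp add: algebra_simps sum.distrib)
  also have "(\<Sum>j\<in>UNIV. of_int (k j) * axis i 1 $ j) = (\<Sum>j\<in>UNIV. if j = i then of_int (k i) else (0::real))"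
    by (intro sum.cong) (auto simp: axis_def)
  also have "\<dots> = k i" by simp
  finally have "wave k \<theta> (x + axis i 1) = cos ((2 * pi * (\<Sum>j\<in>UNIV. of_int (k j) * x $ j) + \<theta>) + 2 * pi * k i)"
    by (simp add: wave_def algebra_simps)
  also have "\<dots> = wave k \<theta> x" 
    by (simp only: cos_add[of _ "2 * pi * k i"] cos_int_2pin sin_int_2pin) (simp add: wave_def)
  finally show "a * wave k \<theta> (x + axis i 1) = a * wave k \<theta> x" by simp
qed

lemma trig_poly_smooth_per: "trig_poly f \<Longrightarrow> f \<in> smooth_per"
proof (induction rule: trig_poly.induct)
  case (wave a k \<theta>)
  then show ?case using smooth_wave cell_periodic_wave by (simp add: smooth_per_def)
next
  case (add f g)
  then show ?case using smooth_add by (simp add: smooth_per_def cell_periodic_def)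
qed

lemma smooth_per_has_derivative:
  assumes "f \<in> smooth_per"
  shows "(f has_derivative (\<lambda>h. grad f x \<bullet> h)) (at x)" "continuous_on UNIV (grad f)"
    "cell_periodic f" "continuous_on UNIV f" "cell_periodic (grad f)"
proof -
  obtain D where D: "D [] = f"
    "\<And>is x. (D is has_derivative (\<lambda>h. \<Sum>i\<in>UNIV. D (i # is) x * h $ i)) (at x)"
    using assms unfolding smooth_per_def smooth_def by blast
  have c: "continuous_on UNIV (D is)" for "is"
    by (intro continuous_at_imp_continuous_on ballI has_derivative_continuous[OF D(2)])
  have d: "(f has_derivative (\<lambda>h. (\<chi> i. D [i] x) \<bullet> h)) (at x)" for x
    using D(2)[of "[]" x] D(1) by (simp add: inner_vec_def)
  have g: "grad f x = (\<chi> i. D [i] x)" for x by (rule grad_eqI[OF d])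
  show "(f has_derivative (\<lambda>h. grad f x \<bullet> h)) (at x)" using d by (simp add: g)
  show "continuous_on UNIV (grad f)"
    unfolding g[abs_def] by (intro continuous_intros c)
  show per: "cell_periodic f" using assms by (simp add: smooth_per_def)
  show "continuous_on UNIV f" using c[of "[]"] D(1) by simp
  show "cell_periodic (grad f)"
    unfolding cell_periodic_def
  proof (intro allI)
    fix x :: "real^2" and i
    \<comment> \<open>Differentiating f (y + axis i 1) = f y transfers periodicity to the gradient,
      by uniqueness of the derivative.\<close>
    have "((\<lambda>y. y + axis i 1) has_derivative (\<lambda>h. h)) (at x)"
      by (auto intro!: derivative_eq_intros)
    then have "((\<lambda>y. f (y + axis i 1)) has_derivative (\<lambda>h. grad f (x + axis i 1) \<bullet> h)) (at x)"
      by (rule has_derivative_compose) (rule d[folded g])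
    moreover have "(\<lambda>y. f (y + axis i 1)) = f" using per by (simp add: cell_periodic_def)
    ultimately show "grad f (x + axis i 1) = grad f x" using grad_eqI by metis
  qed
qed

lemma grad_add:
  assumes "f \<in> smooth_per" "g \<in> smooth_per"
  shows "grad (\<lambda>x. f x + g x) x = grad f x + grad g x"
  by (rule grad_eqI) (use has_derivative_add[OF assms[THEN smooth_per_has_derivative(1)]] in \<open>simp add: inner_add_left\<close>)

lemma pd_wave:
  "pd i (\<lambda>x. a * wave k \<theta> x) = (\<lambda>x. (a * (2 * pi * k i)) * wave k (\<theta> + pi/2) x)"
proof
  fix x
  have "grad (\<lambda>x. a * wave k \<theta> x) x = (\<chi> i. (a * (2 * pi * k i)) * wave k (\<theta> + pi/2) x)"
    by (rule grad_eqI) (use wave_has_derivative[of a k \<theta> x] in \<open>simp add: inner_vec_def\<close>)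
  then show "pd i (\<lambda>x. a * wave k \<theta> x) x = (a * (2 * pi * k i)) * wave k (\<theta> + pi/2) x"
    by (simp add: pd_def)
qed

lemma pd_add:
  assumes "trig_poly f" "trig_poly g"
  shows "pd i (\<lambda>x. f x + g x) = (\<lambda>x. pd i f x + pd i g x)"
  by (simp add: fun_eq_iff pd_def grad_add trig_poly_smooth_per assms)

lemma trig_poly_pd: "trig_poly f \<Longrightarrow> trig_poly (pd i f)"
proof (induction rule: trig_poly.induct)
  case (wave a k \<theta>)
  then show ?case unfolding pd_wave by (rule trig_poly.wave)
next
  case (add f g)
  then show ?case by (simp add: pd_add trig_poly.add)
qed

lemma pd_commute: "trig_poly f \<Longrightarrow> pd i (pd j f) = pd j (pd i f)"
proof (induction rule: trig_poly.induct)
  case (wave a k \<theta>)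
  then show ?case by (simp only: pd_wave) (simp add: ac_simps)
next
  case (add f g)
  then show ?case by (simp add: pd_add trig_poly_pd)
qed

lemma trig_poly_eq_const_plus_laplacian:
  "trig_poly f \<Longrightarrow> \<exists>c \<Phi>. trig_poly \<Phi> \<and> f = (\<lambda>x. c + pd 1 (pd 1 \<Phi>) x + pd 2 (pd 2 \<Phi>) x)"
proof (induction rule: trig_poly.induct)
  case (wave a k \<theta>)
  \<comment> \<open>K is the eigenvalue of minus the Laplacian on the waves of frequency k.\<close>
  define K where "K = 4 * pi\<^sup>2 * ((of_int (k 1))\<^sup>2 + (of_int (k 2))\<^sup>2)"
  have shift: "wave k (\<theta> + pi/2 + pi/2) x = - wave k \<theta> x" for x
    by (simp add: wave_def cos_add sin_add)
  have lap: "pd 1 (pd 1 (\<lambda>x. b * wave k \<theta> x)) x + pd 2 (pd 2 (\<lambda>x. b * wave k \<theta> x)) x = - b * K * wave k \<theta> x" for b x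
    unfolding pd_wave shift by (simp add: K_def power2_eq_square algebra_simps)
  show ?case
  \<comment> \<open>Frequency zero is the kernel of the Laplacian; this mode becomes the constant
    c.\<close>
  proof (cases "k 1 = 0 \<and> k 2 = 0")
    case True
    then have "(\<lambda>x. a * wave k \<theta> x) = (\<lambda>x. a * cos \<theta>)"
      by (simp add: wave_def sum_2)
    \<comment> \<open>The zero potential is written as a wave with coefficient 0 so that the rules
      for waves apply to it.\<close>
    moreover have "pd i (\<lambda>x. 0 * wave k \<theta> x) = (\<lambda>x. 0 * wave k \<theta> x)" for i
      by (simp only: pd_wave) simp
    ultimately show ?thesis
      by (intro exI[of _ "a * cos \<theta>"] exI[of _ "\<lambda>x. 0 * wave k \<theta> x"] conjI trig_poly.wave) (simp only: mult_zero_left add_0_right)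
  next
    case False
    then have "(of_int (k 1))\<^sup>2 + (of_int (k 2))\<^sup>2 \<noteq> (0::real)"
      by (simp add: sum_power2_eq_zero_iff)
    then have "K \<noteq> 0" by (simp add: K_def)
    then have "(\<lambda>x. a * wave k \<theta> x) = (\<lambda>x. 0 + pd 1 (pd 1 (\<lambda>x. (- a / K) * wave k \<theta> x)) x + pd 2 (pd 2 (\<lambda>x. (- a / K) * wave k \<theta> x)) x)"
      using lap[of "- a / K"] by (simp only: add_0_left) simp
    then show ?thesis using trig_poly.wave by blast
  qed
next
  case (add f g)
  then obtain c \<Phi> d \<Psi> where *: "trig_poly \<Phi>" "f = (\<lambda>x. c + pd 1 (pd 1 \<Phi>) x + pd 2 (pd 2 \<Phi>) x)"
    "trig_poly \<Psi>" "g = (\<lambda>x. d + pd 1 (pd 1 \<Psi>) x + pd 2 (pd 2 \<Psi>) x)" by blast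
  show ?case
    by (intro exI[of _ "c + d"] exI[of _ "\<lambda>x. \<Phi> x + \<Psi> x"] conjI trig_poly.add *(1,3))
      (simp add: *(2,4) pd_add trig_poly_pd *(1,3) fun_eq_iff)
qed

section \<open>Density of the trigonometric polynomials\<close>

text \<open>Glues opposite sides of the cell by embedding the torus in C x C, where polynomials
  restrict to trigonometric polynomials.\<close>

definition torus_map :: "real^2 \<Rightarrow> complex \<times> complex" where
  "torus_map x = (cis (2 * pi * x $ 1), cis (2 * pi * x $ 2))"

lemma continuous_torus_map: "continuous_on S torus_map"
  unfolding torus_map_def cis_conv_exp by (intro continuous_intros)

text \<open>The two parameters differ by a nonzero integer, and within the unit interval that
  integer can only be 1 or -1.\<close>

lemma cis_2pi_eq_unit_interval:
  assumes "cis (2 * pi * s) = cis (2 * pi * t)" "s \<in> {0..1}" "t \<in> {0..1}" "s \<noteq> t"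
  shows "s \<in> {0, 1} \<and> t \<in> {0, 1}"
proof -
  have "sin (2 * pi * s) = sin (2 * pi * t) \<and> cos (2 * pi * s) = cos (2 * pi * t)"
    using assms(1) by (simp add: complex_eq_iff)
  then obtain n :: int where "2 * pi * s = 2 * pi * t + 2 * pi * n"
    using sin_cos_eq_iff[of "2 * pi * s" "2 * pi * t"] by auto
  then have "2 * pi * s = 2 * pi * (t + n)" by (simp add: algebra_simps)
  then have "s = t + n" by simp
  then have n: "real_of_int n = s - t" by simp
  then have "real_of_int n \<le> 1" "-1 \<le> real_of_int n" "n \<noteq> 0" using assms by auto
  then have "n = 1 \<or> n = -1" by linarith
  then show ?thesis using n assms by auto
qed

lemma torus_map_eq_boundary:
  assumes "torus_map x = torus_map y" "x \<in> cbox 0 1" "y \<in> cbox 0 1" "x \<noteq> y"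
  shows "x \<notin> box 0 1 \<and> y \<notin> box 0 1"
proof -
  obtain i where i: "x $ i \<noteq> y $ i" using assms(4) by (auto simp: vec_eq_iff)
  have "cis (2 * pi * x $ i) = cis (2 * pi * y $ i)"
    using assms(1) exhaust_2[of i] by (auto simp: torus_map_def)
  moreover have "x $ i \<in> {0..1}" "y $ i \<in> {0..1}" using assms by (auto simp: mem_box_cart)
  ultimately have "x $ i \<in> {0, 1} \<and> y $ i \<in> {0, 1}" using cis_2pi_eq_unit_interval i by blast
  moreover have "z $ i \<notin> {0, 1}" if "z \<in> box 0 1" for z :: "real^2"
    using that by (auto simp: mem_box_cart dest: spec[of _ i])
  ultimately show ?thesis by blast
qed

text \<open>A real-linear functional is fixed by its values on the real basis (1,0), (i,0), (0,1),
  (0,i) of C x C, hence gives a combination of cosines and sines; the phase -pi/2 produces the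
  sines. Sums and products follow from the algebra structure.\<close>

lemma trig_poly_polynomial_torus_map:
  "real_polynomial_function P \<Longrightarrow> trig_poly (\<lambda>x. P (torus_map x))"
proof (induction rule: real_polynomial_function.induct)
  case (linear f)
  then interpret bounded_linear f .
  have eq: "(\<lambda>x. f (torus_map x)) = (\<lambda>x. (f (1, 0) * wave (\<lambda>i. if i = 1 then 1 else 0) 0 x
      + f (\<i>, 0) * wave (\<lambda>i. if i = 1 then 1 else 0) (- pi/2) x)
      + (f (0, 1) * wave (\<lambda>i. if i = 2 then 1 else 0) 0 x
      + f (0, \<i>) * wave (\<lambda>i. if i = 2 then 1 else 0) (- pi/2) x))"
  proof
    fix x
    have "torus_map x = (cos (2 * pi * x $ 1) *\<^sub>R (1, 0) + sin (2 * pi * x $ 1) *\<^sub>R (\<i>, 0))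
        + (cos (2 * pi * x $ 2) *\<^sub>R (0, 1) + sin (2 * pi * x $ 2) *\<^sub>R (0, \<i>))"
      by (simp add: torus_map_def complex_eq_iff)
    then show "f (torus_map x) = (f (1, 0) * wave (\<lambda>i. if i = 1 then 1 else 0) 0 x
      + f (\<i>, 0) * wave (\<lambda>i. if i = 1 then 1 else 0) (- pi/2) x)
      + (f (0, 1) * wave (\<lambda>i. if i = 2 then 1 else 0) 0 x
      + f (0, \<i>) * wave (\<lambda>i. if i = 2 then 1 else 0) (- pi/2) x)"
      by (simp only: add scaleR) (simp add: wave_def sum_2 cos_diff mult.commute)
  qed
  show ?case unfolding eq by (intro trig_poly.intros)
qed (auto intro: trig_poly_const trig_poly.add trig_poly_mult)

text \<open>
  A function vanishing on the boundary of the cell descends to the torus, where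
  polynomials are dense by Stone-Weierstrass.
\<close>

lemma trig_poly_uniform_approx:
  fixes g :: "real^2 \<Rightarrow> real"
  assumes g: "continuous_on (cbox 0 1) g" and bd: "\<And>x. x \<notin> box 0 1 \<Longrightarrow> g x = 0" and "0 < e"
  obtains p where "trig_poly p" "\<And>x. x \<in> cbox 0 1 \<Longrightarrow> \<bar>g x - p x\<bar> < e"
proof -
  let ?C = "cbox 0 (1::real^2)"
  \<comment> \<open>\<open>inv_into\<close> selects one preimage. The choice is immaterial: distinct
    points with the same image lie on the boundary, where g is 0.\<close>
  define h where "h y = g (inv_into ?C torus_map y)" for y
  have h: "h (torus_map x) = g x" if x: "x \<in> ?C" for x
  proof -
    define x' where "x' = inv_into ?C torus_map (torus_map x)"
    have "x' \<in> ?C" "torus_map x' = torus_map x"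
      unfolding x'_def by (auto intro: inv_into_into f_inv_into_f x)
    then have "x' = x \<or> x' \<notin> box 0 1 \<and> x \<notin> box 0 1" using torus_map_eq_boundary x by blast
    then show ?thesis by (auto simp: h_def x'_def[symmetric] bd)
  qed
  have comp: "compact (torus_map ` ?C)"
    by (intro compact_continuous_image continuous_torus_map compact_cbox)
  have "continuous_on (torus_map ` ?C) h"
    \<comment> \<open>The torus carries the quotient topology of the compact cell: a closed preimage
      in the cell is compact, and so is its image.\<close>
    unfolding continuous_on_closed_vimage[OF compact_imp_closed[OF comp]]
  proof (intro allI impI)
    fix B :: "real set" assume "closed B"
    then have "closed (?C \<inter> g -` B)" using g by (intro continuous_closed_preimage) auto
    then have "compact (?C \<inter> (?C \<inter> g -` B))" by (intro compact_Int_closed compact_cbox)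
    then have "compact (torus_map ` (?C \<inter> g -` B))"
      by (intro compact_continuous_image continuous_torus_map) (simp add: Int_assoc[symmetric])
    moreover have "h -` B \<inter> torus_map ` ?C = torus_map ` (?C \<inter> g -` B)" using h by auto
    ultimately show "closed (h -` B \<inter> torus_map ` ?C)" using compact_imp_closed by simp
  qed
  then obtain P where P: "real_polynomial_function P" "\<And>y. y \<in> torus_map ` ?C \<Longrightarrow> \<bar>h y - P y\<bar> < e"
    using Stone_Weierstrass_real_polynomial_function[OF comp _ \<open>0 < e\<close>] by blast
  show thesis
    by (rule that[OF trig_poly_polynomial_torus_map[OF P(1)]]) (metis P(2) h imageI)
qed

text \<open>Almost everywhere approximation by continuous functions is made usable by two changes:
  clipping at B supplies a dominating function, and a cutoff makes the functions vanish on the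
  boundary, as \<open>trig_poly_uniform_approx\<close> requires.\<close>

lemma trig_poly_L2_approx:
  fixes f :: "real^2 \<Rightarrow> real"
  assumes f: "f \<in> borel_measurable cell_measure" and B: "\<And>x. x \<in> cbox 0 1 \<Longrightarrow> \<bar>f x\<bar> \<le> B" and e: "0 < e"
  obtains p where "trig_poly p" "(LINT x|cell_measure. (p x - f x)\<^sup>2) < e"
proof -
  let ?O = "box 0 (1::real^2)"
  have B0: "0 \<le> B" using B[of 0] by (simp add: mem_box_cart)
  have fL2: "L2_cell f" using f B by (intro L2_cellI_bounded[where B=B]) auto
  have "f measurable_on cbox 0 1"
    using f by (simp add: measurable_on_iff_borel_measurable)
  then have "f measurable_on ?O"
    by (rule measurable_on_spike_set) (simp add: box_subset_cbox Diff_eq_empty_iff[THEN iffD2] negligible_frontier_interval)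
  then obtain N g where N: "negligible N" and cg: "\<And>n. continuous_on UNIV (g n)"
    and lim: "\<And>x. x \<notin> N \<Longrightarrow> (\<lambda>n. g n x) \<longlonglongrightarrow> (if x \<in> ?O then f x else 0)"
    unfolding measurable_on_def by blast
  define clip where "clip y = max (- B) (min B y)" for y
  \<comment> \<open>The cutoff is 0 off the open cell and, at each interior point, equals 1 for all
    large n.\<close>
  define cut where "cut n x = min 1 (real n * infdist x (- ?O))" for n and x :: "real^2"
  define G where "G n x = cut n x * clip (g n x)" for n x
  \<comment> \<open>Nonemptiness matters because \<open>infdist\<close> to the empty set is 0 by
    convention.\<close>
  have ne: "- ?O \<noteq> {}" using mem_box_cart(1)[of 0 0 "1::real^2"] by auto
  have cG: "continuous_on UNIV (G n)" for n
    unfolding G_def cut_def clip_def by (intro continuous_intros cg)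
  have cut01: "0 \<le> cut n x" "cut n x \<le> 1" for n x by (auto simp: cut_def infdist_nonneg)
  have GB: "\<bar>G n x\<bar> \<le> B" for n x
  proof -
    have "\<bar>clip (g n x)\<bar> \<le> B" using B0 by (auto simp: clip_def)
    then have "\<bar>cut n x\<bar> * \<bar>clip (g n x)\<bar> \<le> 1 * B"
      using cut01 by (intro mult_mono) auto
    then show ?thesis by (simp add: G_def abs_mult)
  qed
  have G0: "G n x = 0" if "x \<notin> ?O" for n x using that by (simp add: G_def cut_def)
  have Glim: "(\<lambda>n. G n x) \<longlonglongrightarrow> f x" if "x \<notin> N" "x \<in> ?O" for x
  proof -
    have xC: "\<bar>f x\<bar> \<le> B" using B that(2) box_subset_cbox by blast
    have "infdist x (- ?O) \<noteq> 0"
      using that(2) ne in_closed_iff_infdist_zero[OF closed_Compl[OF open_box], of 0 1 x] by simp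
    then have pos: "0 < infdist x (- ?O)" using infdist_nonneg[of x "- ?O"] by linarith
    obtain m where m: "1 < real m * infdist x (- ?O)" using reals_Archimedean3[OF pos] by blast
    have "cut n x = 1" if "m \<le> n" for n
    proof -
      have "real m * infdist x (- ?O) \<le> real n * infdist x (- ?O)"
        using that pos by (intro mult_right_mono) auto
      then show ?thesis using m by (simp add: cut_def)
    qed
    then have "eventually (\<lambda>n. cut n x = 1) sequentially" by (auto intro: eventually_sequentiallyI)
    then have "(\<lambda>n. cut n x) \<longlonglongrightarrow> 1" by (rule tendsto_eventually)
    moreover have "(\<lambda>n. clip (g n x)) \<longlonglongrightarrow> clip (f x)"
      unfolding clip_def using lim[OF that(1)] that(2) by (intro tendsto_intros) simp
    ultimately have "(\<lambda>n. G n x) \<longlonglongrightarrow> 1 * clip (f x)"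
      unfolding G_def by (rule tendsto_mult)
    moreover have "clip (f x) = f x" using xC by (auto simp: clip_def)
    ultimately show ?thesis by simp
  qed
  have "AE x in cell_measure. x \<notin> N \<and> x \<in> ?O"
  proof -
    have "negligible (N \<union> (cbox 0 1 - ?O))"
      by (intro negligible_Un N negligible_frontier_interval)
    then have "N \<union> (cbox 0 1 - ?O) \<in> null_sets lebesgue" by (simp add: negligible_iff_null_sets)
    then have "AE x in lebesgue. x \<notin> N \<union> (cbox 0 1 - ?O)" by (rule AE_not_in)
    then show ?thesis by (subst AE_restrict_space_iff) auto
  qed
  then have AElim: "AE x in cell_measure. (\<lambda>n. (G n x - f x)\<^sup>2) \<longlonglongrightarrow> 0"
    by eventually_elim (auto intro!: tendsto_eq_intros Glim)
  have "(\<lambda>n. LINT x|cell_measure. (G n x - f x)\<^sup>2) \<longlonglongrightarrow> (LINT x|cell_measure. 0)"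
  proof (rule integral_dominated_convergence[where w="\<lambda>x. (2 * B)\<^sup>2"])
    show "integrable cell_measure (\<lambda>x. (2 * B)\<^sup>2)" by (rule integrable_cell_continuous) simp
    show "(\<lambda>x. (G n x - f x)\<^sup>2) \<in> borel_measurable cell_measure" for n
      using f measurable_cell_continuous[OF cG] by measurable
    show "AE x in cell_measure. norm ((G n x - f x)\<^sup>2) \<le> (2 * B)\<^sup>2" for n
    proof (rule AE_I2)
      fix x assume "x \<in> space cell_measure"
      then have "\<bar>f x\<bar> \<le> B" using B by (simp add: space_restrict_space)
      then have "\<bar>G n x - f x\<bar> \<le> \<bar>2 * B\<bar>" using GB[of n x] by linarith
      then show "norm ((G n x - f x)\<^sup>2) \<le> (2 * B)\<^sup>2" by (simp add: abs_le_square_iff)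
    qed
  qed (use AElim in auto)
  \<comment> \<open>Two errors of e/4, each doubled by the squared triangle inequality, add up to
    e.\<close>
  then have "eventually (\<lambda>n. (LINT x|cell_measure. (G n x - f x)\<^sup>2) < e / 4) sequentially"
    using e by (intro order_tendstoD) auto
  then obtain n where n: "(LINT x|cell_measure. (G n x - f x)\<^sup>2) < e / 4"
    by (auto simp: eventually_sequentially)
  obtain p where p: "trig_poly p" "\<And>x. x \<in> cbox 0 1 \<Longrightarrow> \<bar>G n x - p x\<bar> < sqrt (e / 4)"
    using trig_poly_uniform_approx[of "G n" "sqrt (e / 4)"] continuous_on_subset[OF cG] G0 e by auto
  have cp: "continuous_on UNIV p" using smooth_per_has_derivative(4)[OF trig_poly_smooth_per[OF p(1)]] .
  have "(LINT x|cell_measure. (p x - G n x)\<^sup>2) \<le> (LINT x|cell_measure. e / 4)"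
  proof (rule integral_mono)
    fix x assume "x \<in> space cell_measure"
    then have "\<bar>p x - G n x\<bar> \<le> sqrt (e / 4)" using p(2)[of x] by (simp add: space_restrict_space abs_minus_commute)
    then have "(\<bar>p x - G n x\<bar>)\<^sup>2 \<le> (sqrt (e / 4))\<^sup>2" by (intro power_mono) auto
    then show "(p x - G n x)\<^sup>2 \<le> e / 4" using e by simp
  qed (auto intro!: integrable_cell_continuous continuous_intros cp cG)
  then have "(LINT x|cell_measure. (p x - G n x)\<^sup>2) \<le> e / 4"
    by (simp only: integral_cell_const)
  moreover have "(LINT x|cell_measure. (p x - f x)\<^sup>2) \<le>
      2 * (LINT x|cell_measure. (p x - G n x)\<^sup>2) + 2 * (LINT x|cell_measure. (G n x - f x)\<^sup>2)"
    using L2_integral_add_square[of "\<lambda>x. p x - G n x" "\<lambda>x. G n x - f x"]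
      L2_cell_diff[OF L2_cell_continuous[OF cp] L2_cell_continuous[OF cG[of n]]]
      L2_cell_diff[OF L2_cell_continuous[OF cG[of n]] fL2] by simp
  ultimately have "(LINT x|cell_measure. (p x - f x)\<^sup>2) < e" using n by linarith
  then show thesis using that p(1) by blast
qed

section \<open>Helmholtz decomposition\<close>

lemma R_perp_mult: "R_perp *v v = vector [- v $ 2, v $ 1]"
  by (simp add: vec_eq_iff forall_2 R_perp_def matrix_vector_mult_def sum_2)

lemma inner_real2: "(v::real^2) \<bullet> w = v $ 1 * w $ 1 + v $ 2 * w $ 2"
  by (simp add: inner_vec_def sum_2)

lemma R_perp_inner: "(R_perp *v v) \<bullet> w = - (v \<bullet> (R_perp *v w))"
  by (simp add: R_perp_mult inner_real2)

lemma norm_R_perp: "norm (R_perp *v v) = norm v"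
  by (simp add: norm_eq_sqrt_inner R_perp_mult inner_real2)

lemma L2_cell_R_perp: "L2_cell G \<Longrightarrow> L2_cell (\<lambda>x. R_perp *v G x)"
  by (rule L2_cell_linear[OF _ matrix_vector_mul_bounded_linear])

lemma L2_cell_grad: "\<psi> \<in> smooth_per \<Longrightarrow> L2_cell (grad \<psi>)"
  by (intro L2_cell_continuous smooth_per_has_derivative)

lemma integral_cell_const_inner_grad:
  assumes "\<psi> \<in> smooth_per"
  shows "(LINT x|cell_measure. c \<bullet> grad \<psi> x) = 0"
proof -
  note d = smooth_per_has_derivative[OF assms]
  have "integrable cell_measure (\<lambda>x. grad \<psi> x $ i)" for i
    by (intro integrable_cell_continuous continuous_intros d)
  then show ?thesis
    by (simp add: inner_real2 integral_cell_derivative_periodic[OF d(1,2,3)])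
qed

lemma div_free_const: "div_free (\<lambda>x. c)"
  by (simp add: div_free_def L2_cell_const integral_cell_const_inner_grad cell_periodic_def)

lemma integral_cell_by_parts:
  assumes a: "a \<in> smooth_per" and b: "b \<in> smooth_per"
  shows "(LINT x|cell_measure. a x * pd i b x + b x * pd i a x) = 0"
proof -
  note da = smooth_per_has_derivative[OF a] and db = smooth_per_has_derivative[OF b]
  have "((\<lambda>x. a x * b x) has_derivative (\<lambda>h. (a x *\<^sub>R grad b x + b x *\<^sub>R grad a x) \<bullet> h)) (at x)" for x
    by (rule has_derivative_eq_rhs[OF has_derivative_mult[OF da(1) db(1)]]) (simp add: inner_add_left mult.commute)
  moreover have "continuous_on UNIV (\<lambda>x. a x *\<^sub>R grad b x + b x *\<^sub>R grad a x)"
    by (intro continuous_intros da db)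
  moreover have "cell_periodic (\<lambda>x. a x * b x)" using da(3) db(3) by (simp add: cell_periodic_def)
  ultimately have "(LINT x|cell_measure. (a x *\<^sub>R grad b x + b x *\<^sub>R grad a x) $ i) = 0"
    by (rule integral_cell_derivative_periodic)
  then show ?thesis by (simp add: pd_def)
qed

text \<open>The integrand is the derivative of \<psi> (pd 1 v) in direction 2 minus that of \<psi>
  (pd 2 v) in direction 1: the added second-order terms cancel because mixed derivatives
  commute.\<close>

lemma R_perp_grad_orthogonal_grad:
  assumes v: "trig_poly v" and \<psi>: "\<psi> \<in> smooth_per"
  shows "(LINT x|cell_measure. (R_perp *v grad v x) \<bullet> grad \<psi> x) = 0"
proof -
  note sp = trig_poly_smooth_per[OF trig_poly_pd[OF v]]
  have c: "continuous_on UNIV (pd i a)" if "a \<in> smooth_per" for i a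
    unfolding pd_def[abs_def] by (intro continuous_intros smooth_per_has_derivative that)
  have "(R_perp *v grad v x) \<bullet> grad \<psi> x =
      (pd 1 v x * pd 2 \<psi> x + \<psi> x * pd 2 (pd 1 v) x) - (pd 2 v x * pd 1 \<psi> x + \<psi> x * pd 1 (pd 2 v) x)" for x
    using pd_commute[OF v, of 1 2] by (simp add: R_perp_mult inner_real2 pd_def)
  moreover have "integrable cell_measure (\<lambda>x. pd i v x * pd j \<psi> x + \<psi> x * pd j (pd i v) x)" for i j
    by (intro integrable_cell_continuous continuous_intros c \<psi> sp smooth_per_has_derivative)
      (use v trig_poly_smooth_per in blast)
  ultimately show ?thesis
    by (simp add: integral_cell_by_parts[OF sp \<psi>])
qed

text \<open>Extends the admissible test fields from smooth gradients to all H^1 gradients by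
  density. Uniqueness of the cell field and the vanishing mean of gradients both use it.\<close>

lemma div_free_orthogonal_H1_per_grad:
  assumes J: "div_free J" and G: "H1_per_grad \<phi> G"
  shows "(LINT x|cell_measure. J x \<bullet> G x) = 0"
proof -
  obtain \<psi> where \<psi>: "\<And>n. \<psi> n \<in> smooth_per"
    and lim: "(\<lambda>n. LINT x|cell_measure. (norm (grad (\<psi> n) x - G x))\<^sup>2) \<longlonglongrightarrow> 0"
    using G unfolding H1_per_grad_def by blast
  have "(\<lambda>n. LINT x|cell_measure. grad (\<psi> n) x \<bullet> J x) \<longlonglongrightarrow> (LINT x|cell_measure. G x \<bullet> J x)"
    using J G by (intro L2_inner_tendsto[OF L2_cell_grad[OF \<psi>] _ _ lim]) (auto simp: div_free_def H1_per_grad_def)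
  moreover have "(LINT x|cell_measure. grad (\<psi> n) x \<bullet> J x) = 0" for n
    using J \<psi> by (simp add: div_free_def inner_commute)
  ultimately show ?thesis by (simp add: LIMSEQ_const_iff inner_commute)
qed

lemma grad_trig_diff:
  assumes "trig_poly f" "trig_poly g"
  shows "grad (\<lambda>x. f x - g x) x = grad f x - grad g x"
  by (rule grad_eqI)
    (use has_derivative_diff[OF assms[THEN trig_poly_smooth_per, THEN smooth_per_has_derivative(1)]] in \<open>simp add: inner_diff_left\<close>)

lemma pd_diff:
  assumes "trig_poly f" "trig_poly g"
  shows "pd i (\<lambda>x. f x - g x) = (\<lambda>x. pd i f x - pd i g x)"
  by (simp add: fun_eq_iff pd_def grad_trig_diff assms)

text \<open>Fixes the free additive constant of a potential so that the Poincare inequality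
  applies.\<close>

lemma trig_poly_mean_zero:
  assumes u: "trig_poly u"
  obtains u' where "trig_poly u'" "grad u' = grad u" "(LINT x|cell_measure. u' x) = 0"
proof -
  define c where "c = (LINT x|cell_measure. u x)"
  have "grad (\<lambda>x. c) x = 0" for x by (rule grad_eqI) simp
  then have "grad (\<lambda>x. u x - c) = grad u"
    by (simp add: fun_eq_iff grad_trig_diff[OF u trig_poly_const])
  moreover have "integrable cell_measure u"
    by (intro integrable_cell_continuous smooth_per_has_derivative trig_poly_smooth_per u)
  then have "(LINT x|cell_measure. u x - c) = 0"
    by (subst Bochner_Integration.integral_diff)
      (auto simp: integral_cell_const c_def intro!: integrable_cell_continuous simp del: lebesgue_integral_const)
  ultimately show thesis using that[OF trig_poly_diff[OF u trig_poly_const]] by blast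
qed

lemma trig_poly_helmholtz:
  assumes p: "\<And>i::2. trig_poly (p i)"
  obtains c u v where "trig_poly u" "trig_poly v"
    "(LINT x|cell_measure. u x) = 0" "(LINT x|cell_measure. v x) = 0"
    "\<And>x. (\<chi> i. p i x) = c + (grad u x + R_perp *v grad v x)"
proof -
  have "\<forall>i. \<exists>c \<Phi>. trig_poly \<Phi> \<and> p i = (\<lambda>x. c + pd 1 (pd 1 \<Phi>) x + pd 2 (pd 2 \<Phi>) x)"
    using trig_poly_eq_const_plus_laplacian[OF p] by blast
  then obtain c \<Phi> where \<Phi>: "\<And>i. trig_poly (\<Phi> i)"
    and pe: "\<And>i. p i = (\<lambda>x. c i + pd 1 (pd 1 (\<Phi> i)) x + pd 2 (pd 2 (\<Phi> i)) x)" by metis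
  \<comment> \<open>\<open>\<Delta> = grad div + R_perp grad curl\<close>, applied to the field \<open>\<Phi>\<close>\<close>
  define u where "u = (\<lambda>x. pd 1 (\<Phi> 1) x + pd 2 (\<Phi> 2) x)"
  define v where "v = (\<lambda>x. pd 1 (\<Phi> 2) x - pd 2 (\<Phi> 1) x)"
  have t: "trig_poly u" "trig_poly v" unfolding u_def v_def
    by (intro trig_poly.add trig_poly_diff trig_poly_pd \<Phi>)+
  have gu: "grad u x $ i = pd i (pd 1 (\<Phi> 1)) x + pd i (pd 2 (\<Phi> 2)) x" for i x
    unfolding pd_def[symmetric] u_def by (simp add: pd_add trig_poly_pd \<Phi>)
  have gv: "grad v x $ i = pd i (pd 1 (\<Phi> 2)) x - pd i (pd 2 (\<Phi> 1)) x" for i x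
    unfolding pd_def[symmetric] v_def by (simp add: pd_diff trig_poly_pd \<Phi>)
  have eq: "(\<chi> i. p i x) = (\<chi> i. c i) + (grad u x + R_perp *v grad v x)" for x
    using pd_commute[OF \<Phi>, of 1 2 1] pd_commute[OF \<Phi>, of 1 2 2]
    by (simp add: vec_eq_iff forall_2 R_perp_mult gu gv pe)
  obtain u' where "trig_poly u'" "grad u' = grad u" "(LINT x|cell_measure. u' x) = 0"
    using trig_poly_mean_zero[OF t(1)] .
  moreover obtain v' where "trig_poly v'" "grad v' = grad v" "(LINT x|cell_measure. v' x) = 0"
    using trig_poly_mean_zero[OF t(2)] .
  ultimately show thesis using that[of u' v' "\<chi> i. c i"] eq by simp
qed

text \<open>The bound makes the gradients Cauchy, and Poincare applied to differences makes the
  potentials Cauchy. The two limits use different subsequences r and s, which is harmless: in both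
  cases the full sequence converges in L^2. Orthogonality of the rotated gradients to smooth
  gradients passes to the limit.\<close>

lemma trig_poly_H1_limit:
  fixes u :: "nat \<Rightarrow> real^2 \<Rightarrow> real"
  assumes u: "\<And>n. trig_poly (u n)" and mean: "\<And>n. (LINT x|cell_measure. u n x) = 0"
    and bound: "\<And>m n. (LINT x|cell_measure. (norm (grad (u m) x - grad (u n) x))\<^sup>2) \<le> a m + a n"
    and a: "a \<longlonglongrightarrow> (0::real)"
  obtains \<phi> G where "H1_per_grad \<phi> G" "div_free (\<lambda>x. R_perp *v G x)"
    "(\<lambda>n. LINT x|cell_measure. (norm (grad (u n) x - G x))\<^sup>2) \<longlonglongrightarrow> 0"
proof -
  note sp = trig_poly_smooth_per[OF u]
  have small: "\<exists>N. \<forall>m\<ge>N. \<forall>n\<ge>N. a m + a n < e" if "e > 0" for e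
  proof -
    have "eventually (\<lambda>n. a n < e / 2) sequentially" using a that by (intro order_tendstoD) auto
    then obtain N where "\<And>n. n \<ge> N \<Longrightarrow> a n < e / 2" by (auto simp: eventually_sequentially)
    then have "\<forall>m\<ge>N. \<forall>n\<ge>N. a m + a n < e / 2 + e / 2" using add_strict_mono by blast
    then show ?thesis by auto
  qed
  have poin: "(LINT x|cell_measure. (norm (u m x - u n x))\<^sup>2) \<le> a m + a n" for m n
  proof -
    note spd = trig_poly_smooth_per[OF trig_poly_diff[OF u u]]
    have int: "integrable cell_measure (u k)" for k
      by (intro integrable_cell_continuous smooth_per_has_derivative sp)
    have "(LINT x|cell_measure. (u m x - u n x)\<^sup>2) \<le> (LINT x|cell_measure. (norm (grad (\<lambda>x. u m x - u n x) x))\<^sup>2)"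
      by (rule poincare_cell[OF smooth_per_has_derivative(1,2)[OF spd]]) (simp add: mean int)
    also have "\<dots> \<le> a m + a n" using bound by (simp add: grad_trig_diff u)
    finally show ?thesis by simp
  qed
  have Cu: "\<exists>N. \<forall>m\<ge>N. \<forall>n\<ge>N. (LINT x|cell_measure. (norm (u m x - u n x))\<^sup>2) < e" if "e > 0" for e
    using small[OF that] poin by (meson order_le_less_trans)
  obtain r where r: "L2_cell (\<lambda>x. lim (\<lambda>k. u (r k) x))"
    "(\<lambda>n. LINT x|cell_measure. (norm (u n x - lim (\<lambda>k. u (r k) x)))\<^sup>2) \<longlonglongrightarrow> 0"
    by (rule L2_complete[OF L2_cell_continuous[OF smooth_per_has_derivative(4)[OF sp]] Cu])
  have Cg: "\<exists>N. \<forall>m\<ge>N. \<forall>n\<ge>N. (LINT x|cell_measure. (norm (grad (u m) x - grad (u n) x))\<^sup>2) < e" if "e > 0" for e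
    using small[OF that] bound by (meson order_le_less_trans)
  obtain s where s: "L2_cell (\<lambda>x. lim (\<lambda>k. grad (u (s k)) x))"
    "(\<lambda>n. LINT x|cell_measure. (norm (grad (u n) x - lim (\<lambda>k. grad (u (s k)) x)))\<^sup>2) \<longlonglongrightarrow> 0"
    by (rule L2_complete[OF L2_cell_grad[OF sp] Cg])
  define \<phi> where "\<phi> x = lim (\<lambda>k. u (r k) x)" for x
  define G where "G x = lim (\<lambda>k. grad (u (s k)) x)" for x
  have per: "cell_periodic \<phi>" "cell_periodic G"
    using smooth_per_has_derivative(3,5)[OF sp] by (simp_all add: cell_periodic_def \<phi>_def G_def)
  have L2G: "L2_cell G" using s(1) by (simp add: G_def[abs_def])
  have limG: "(\<lambda>n. LINT x|cell_measure. (norm (grad (u n) x - G x))\<^sup>2) \<longlonglongrightarrow> 0" using s(2) by (simp add: G_def)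
  have "H1_per_grad \<phi> G"
    unfolding H1_per_grad_def
    using per r L2G limG sp by (auto simp: \<phi>_def[abs_def] intro!: exI[of _ u])
  moreover have "div_free (\<lambda>x. R_perp *v G x)"
    unfolding div_free_def
  proof (intro conjI ballI)
    show "cell_periodic (\<lambda>x. R_perp *v G x)" using per(2) by (simp add: cell_periodic_def)
    show "L2_cell (\<lambda>x. R_perp *v G x)" using L2G by (rule L2_cell_R_perp)
    fix \<psi> assume \<psi>: "\<psi> \<in> smooth_per"
    have "(\<lambda>n. LINT x|cell_measure. grad (u n) x \<bullet> (R_perp *v grad \<psi> x)) \<longlonglongrightarrow>
        (LINT x|cell_measure. G x \<bullet> (R_perp *v grad \<psi> x))"
      by (intro L2_inner_tendsto L2_cell_grad L2_cell_R_perp sp \<psi> L2G limG)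
    moreover have "(LINT x|cell_measure. grad (u n) x \<bullet> (R_perp *v grad \<psi> x)) = 0" for n
      using R_perp_grad_orthogonal_grad[OF u \<psi>] by (simp add: R_perp_inner)
    ultimately show "(LINT x|cell_measure. (R_perp *v G x) \<bullet> grad \<psi> x) = 0"
      by (simp add: R_perp_inner LIMSEQ_const_iff)
  qed
  ultimately show thesis using that limG by blast
qed

lemma R_perp_diff: "R_perp *v a - R_perp *v b = R_perp *v (a - b)"
  by (simp add: matrix_vector_mult_diff_distrib)

lemma helmholtz_decomposition:
  fixes f :: "real^2 \<Rightarrow> real^2"
  assumes f: "f \<in> borel_measurable cell_measure" and B: "\<And>x. x \<in> cbox 0 1 \<Longrightarrow> norm (f x) \<le> B"
    and mean: "(LINT x|cell_measure. f x) = 0"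
  obtains \<phi>1 G1 \<phi>2 G2 where "H1_per_grad \<phi>1 G1" "div_free (\<lambda>x. R_perp *v G1 x)"
    "H1_per_grad \<phi>2 G2" "div_free (\<lambda>x. R_perp *v G2 x)"
    "AE x in cell_measure. f x = G1 x + R_perp *v G2 x"
proof -
  have L2f: "L2_cell f" by (rule L2_cellI_bounded[OF f B])
  have "\<forall>n i. \<exists>p. trig_poly p \<and> (LINT x|cell_measure. (p x - f x $ i)\<^sup>2) < inverse (real (Suc n))"
  proof (intro allI)
    fix n :: nat and i :: 2
    have fB: "\<bar>f x $ i\<bar> \<le> B" if "x \<in> cbox 0 1" for x
      using component_le_norm_cart[of "f x" i] B[OF that] by linarith
    have fm: "(\<lambda>x. f x $ i) \<in> borel_measurable cell_measure"
      using borel_measurable_inner[OF f borel_measurable_const, of "axis i 1"] by (simp add: inner_axis)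
    obtain p where "trig_poly p" "(LINT x|cell_measure. (p x - f x $ i)\<^sup>2) < inverse (real (Suc n))"
      by (rule trig_poly_L2_approx[OF fm fB, of "inverse (real (Suc n))"]) auto
    then show "\<exists>p. trig_poly p \<and> (LINT x|cell_measure. (p x - f x $ i)\<^sup>2) < inverse (real (Suc n))" by blast
  qed
  then obtain p where "\<forall>n i. trig_poly (p n i) \<and> (LINT x|cell_measure. (p n i x - f x $ i)\<^sup>2) < inverse (real (Suc n))"
    unfolding choice_iff by blast
  then have p: "\<And>n i. trig_poly (p n i)"
    and pf: "\<And>n i. (LINT x|cell_measure. (p n i x - f x $ i)\<^sup>2) < inverse (real (Suc n))" by blast+
  have "\<forall>n. \<exists>c u v. trig_poly u \<and> trig_poly v \<and> (LINT x|cell_measure. u x) = 0 \<and> (LINT x|cell_measure. v x) = 0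
      \<and> (\<forall>x. (\<chi> i. p n i x) = c + (grad u x + R_perp *v grad v x))"
  proof
    fix n
    show "\<exists>c u v. trig_poly u \<and> trig_poly v \<and> (LINT x|cell_measure. u x) = 0 \<and> (LINT x|cell_measure. v x) = 0
      \<and> (\<forall>x. (\<chi> i. p n i x) = c + (grad u x + R_perp *v grad v x))"
      by (rule trig_poly_helmholtz[of "p n", OF p]) blast
  qed
  then obtain c u v where "\<forall>n. trig_poly (u n) \<and> trig_poly (v n) \<and> (LINT x|cell_measure. u n x) = 0 \<and> (LINT x|cell_measure. v n x) = 0
      \<and> (\<forall>x. (\<chi> i. p n i x) = c n + (grad (u n) x + R_perp *v grad (v n) x))"
    unfolding choice_iff by blast
  then have u: "\<And>n. trig_poly (u n)" and v: "\<And>n. trig_poly (v n)"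
    and mu: "\<And>n. (LINT x|cell_measure. u n x) = 0" and mv: "\<And>n. (LINT x|cell_measure. v n x) = 0"
    and eq: "\<And>n x. (\<chi> i. p n i x) = c n + (grad (u n) x + R_perp *v grad (v n) x)"
    by blast+
  note spu = trig_poly_smooth_per[OF u] and spv = trig_poly_smooth_per[OF v]
  note L2u = L2_cell_grad[OF spu] and L2v = L2_cell_grad[OF spv]
  define F where "F n x = grad (u n) x + R_perp *v grad (v n) x" for n x
  have L2F: "L2_cell (F n)" for n
    unfolding F_def by (intro L2_cell_add L2_cell_R_perp L2u L2v)
  have L2Ff: "L2_cell (\<lambda>x. F n x - f x)" for n by (intro L2_cell_diff L2F L2f)
  define a where "a n = (LINT x|cell_measure. (norm (F n x - f x))\<^sup>2)" for n
  \<comment> \<open>The constant c n is L^2-orthogonal to F n - f, because gradients, rotated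
    gradients and f all have mean zero. Dropping it can only reduce the error; the factor 2 counts
    the two components of f.\<close>
  have a2: "a n \<le> 2 * inverse (real (Suc n))" for n
  proof -
    have 0: "(LINT x|cell_measure. c n \<bullet> (F n x - f x)) = 0"
    proof -
      have "(LINT x|cell_measure. c n \<bullet> (R_perp *v grad (v n) x)) = 0"
        using integral_cell_const_inner_grad[OF spv, of "R_perp *v c n" n] by (simp add: R_perp_inner)
      moreover have "(LINT x|cell_measure. c n \<bullet> f x) = 0"
        using integral_inner_right[OF integrable_L2[OF L2f], of "c n"] mean by simp
      ultimately show ?thesis
        using integrable_L2_inner[OF L2_cell_const[of "c n"] L2u[of n]]
          integrable_L2_inner[OF L2_cell_const[of "c n"] L2_cell_R_perp[OF L2v[of n]]]
          integrable_L2_inner[OF L2_cell_const[of "c n"] L2f]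
        by (simp add: F_def inner_diff_right inner_add_right integral_cell_const_inner_grad[OF spu])
    qed
    have "a n \<le> (LINT x|cell_measure. (norm (c n))\<^sup>2 + (norm (F n x - f x))\<^sup>2 + 2 * (c n \<bullet> (F n x - f x)))"
      using 0 L2Ff[of n] integrable_L2_inner[OF L2_cell_const[of "c n"] L2Ff[of n]]
        integrable_L2[OF L2_cell_const[of "(norm (c n))\<^sup>2"]]
      by (simp add: a_def L2_cell_def integral_cell_const del: lebesgue_integral_const)
    also have "\<dots> = (LINT x|cell_measure. (p n 1 x - f x $ 1)\<^sup>2 + (p n 2 x - f x $ 2)\<^sup>2)"
    proof (rule Bochner_Integration.integral_cong)
      fix x
      have "(norm (c n))\<^sup>2 + (norm (F n x - f x))\<^sup>2 + 2 * (c n \<bullet> (F n x - f x)) = (norm (c n + (F n x - f x)))\<^sup>2"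
        by (simp add: power2_norm_eq_inner inner_add inner_commute)
      also have "c n + (F n x - f x) = (\<chi> i. p n i x) - f x" by (simp add: eq F_def)
      also have "(norm \<dots>)\<^sup>2 = (p n 1 x - f x $ 1)\<^sup>2 + (p n 2 x - f x $ 2)\<^sup>2"
        by (simp only: power2_norm_eq_inner inner_real2) (simp add: power2_eq_square)
      finally show "(norm (c n))\<^sup>2 + (norm (F n x - f x))\<^sup>2 + 2 * (c n \<bullet> (F n x - f x)) =
        (p n 1 x - f x $ 1)\<^sup>2 + (p n 2 x - f x $ 2)\<^sup>2" .
    qed simp
    also have "\<dots> = (LINT x|cell_measure. (p n 1 x - f x $ 1)\<^sup>2) + (LINT x|cell_measure. (p n 2 x - f x $ 2)\<^sup>2)"
    proof (rule Bochner_Integration.integral_add)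
      have "L2_cell (\<lambda>x. p n i x - f x $ i)" for i
        by (intro L2_cell_diff L2_cell_linear[OF L2f bounded_linear_vec_nth]
            L2_cell_continuous smooth_per_has_derivative(4) trig_poly_smooth_per p)
      then show "integrable cell_measure (\<lambda>x. (p n 1 x - f x $ 1)\<^sup>2)" "integrable cell_measure (\<lambda>x. (p n 2 x - f x $ 2)\<^sup>2)"
        by (auto simp: L2_cell_def)
    qed
    also have "\<dots> \<le> 2 * inverse (real (Suc n))" using pf[of n 1] pf[of n 2] by linarith
    finally show ?thesis .
  qed
  have a0: "a \<longlonglongrightarrow> 0"
  proof (rule tendsto_sandwich[of "\<lambda>_. 0" a sequentially "\<lambda>n. 2 * inverse (real (Suc n))"])
    show "(\<lambda>n. 2 * inverse (real (Suc n))) \<longlonglongrightarrow> 0"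
      using tendsto_mult_right[OF LIMSEQ_inverse_real_of_nat, of 2] by simp
    show "\<forall>\<^sub>F n in sequentially. a n \<le> 2 * inverse (real (Suc n))" by (intro always_eventually allI a2)
    show "\<forall>\<^sub>F n in sequentially. 0 \<le> a n" by (simp add: a_def)
  qed simp
  \<comment> \<open>Orthogonality of gradients and rotated gradients turns closeness of the sums F m
    and F n into closeness of each part.\<close>
  have pyth: "(LINT x|cell_measure. (norm (F m x - F n x))\<^sup>2) =
      (LINT x|cell_measure. (norm (grad (u m) x - grad (u n) x))\<^sup>2) + (LINT x|cell_measure. (norm (grad (v m) x - grad (v n) x))\<^sup>2)" for m n
  proof -
    let ?U = "\<lambda>x. grad (u m) x - grad (u n) x" and ?V = "\<lambda>x. grad (v m) x - grad (v n) x"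
    have L: "L2_cell ?U" "L2_cell ?V" by (intro L2_cell_diff L2u L2v)+
    have "(norm (F m x - F n x))\<^sup>2 = (norm (?U x))\<^sup>2 + (norm (?V x))\<^sup>2 + 2 * ((R_perp *v ?V x) \<bullet> ?U x)" for x
    proof -
      have "F m x - F n x = ?U x + R_perp *v ?V x" by (simp add: F_def R_perp_diff[symmetric])
      then have "(norm (F m x - F n x))\<^sup>2 = (norm (?U x))\<^sup>2 + (norm (R_perp *v ?V x))\<^sup>2 + 2 * ((R_perp *v ?V x) \<bullet> ?U x)"
        by (simp only: power2_norm_eq_inner inner_add) (simp add: inner_commute)
      then show ?thesis by (simp only: norm_R_perp)
    qed
    moreover have "(LINT x|cell_measure. (R_perp *v ?V x) \<bullet> ?U x) = 0"
      using R_perp_grad_orthogonal_grad[OF trig_poly_diff[OF v v, of m n] trig_poly_smooth_per[OF trig_poly_diff[OF u u]], of m n]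
      by (simp add: grad_trig_diff u v)
    ultimately show ?thesis
      using L integrable_L2_inner[OF L2_cell_R_perp[OF L(2)] L(1)] by (simp add: L2_cell_def)
  qed
  have FC: "(LINT x|cell_measure. (norm (F m x - F n x))\<^sup>2) \<le> 2 * a m + 2 * a n" for m n
    unfolding a_def by (rule L2_integral_diff_square[OF L2F L2F L2f])
  have bu: "(LINT x|cell_measure. (norm (grad (u m) x - grad (u n) x))\<^sup>2) \<le> 2 * a m + 2 * a n"
    and bv: "(LINT x|cell_measure. (norm (grad (v m) x - grad (v n) x))\<^sup>2) \<le> 2 * a m + 2 * a n" for m n
  proof -
    have "0 \<le> (LINT x|cell_measure. (norm (grad (w m) x - grad (w n) x))\<^sup>2)" for w :: "nat \<Rightarrow> real^2 \<Rightarrow> real" by simp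
    from this[of u] this[of v] show "(LINT x|cell_measure. (norm (grad (u m) x - grad (u n) x))\<^sup>2) \<le> 2 * a m + 2 * a n"
      "(LINT x|cell_measure. (norm (grad (v m) x - grad (v n) x))\<^sup>2) \<le> 2 * a m + 2 * a n"
      using pyth[of m n] FC[of m n] by linarith+
  qed
  have a0': "(\<lambda>n. 2 * a n) \<longlonglongrightarrow> 0" using tendsto_mult_right[OF a0, of 2] by simp
  obtain \<phi>1 G1 where 1: "H1_per_grad \<phi>1 G1" "div_free (\<lambda>x. R_perp *v G1 x)"
    "(\<lambda>n. LINT x|cell_measure. (norm (grad (u n) x - G1 x))\<^sup>2) \<longlonglongrightarrow> 0"
    using trig_poly_H1_limit[OF u mu bu a0'] by blast
  obtain \<phi>2 G2 where 2: "H1_per_grad \<phi>2 G2" "div_free (\<lambda>x. R_perp *v G2 x)"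
    "(\<lambda>n. LINT x|cell_measure. (norm (grad (v n) x - G2 x))\<^sup>2) \<longlonglongrightarrow> 0"
    using trig_poly_H1_limit[OF v mv bv a0'] by blast
  have LG: "L2_cell G1" "L2_cell G2" using 1(1) 2(1) by (auto simp: H1_per_grad_def)
  define H where "H x = G1 x + R_perp *v G2 x" for x
  have LH: "L2_cell H" unfolding H_def by (intro L2_cell_add L2_cell_R_perp LG)
  \<comment> \<open>The coefficients come from two nested uses of the squared triangle inequality.
    The quantity bounded by ?b n does not depend on n, so it must vanish in the limit.\<close>
  let ?b = "\<lambda>n. 4 * (LINT x|cell_measure. (norm (grad (u n) x - G1 x))\<^sup>2) + 4 * (LINT x|cell_measure. (norm (grad (v n) x - G2 x))\<^sup>2) + 2 * a n"
  have "(LINT x|cell_measure. (norm (f x - H x))\<^sup>2) \<le> ?b n" for n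
  proof -
    have "(LINT x|cell_measure. (norm (f x - H x))\<^sup>2) \<le>
      2 * (LINT x|cell_measure. (norm (f x - F n x))\<^sup>2) + 2 * (LINT x|cell_measure. (norm (H x - F n x))\<^sup>2)"
      by (rule L2_integral_diff_square[OF L2f LH L2F])
    moreover have "(LINT x|cell_measure. (norm (H x - F n x))\<^sup>2) \<le>
      2 * (LINT x|cell_measure. (norm (G1 x - grad (u n) x))\<^sup>2) + 2 * (LINT x|cell_measure. (norm (G2 x - grad (v n) x))\<^sup>2)"
    proof -
      have "H x - F n x = (G1 x - grad (u n) x) + R_perp *v (G2 x - grad (v n) x)" for x
        by (simp add: H_def F_def R_perp_diff[symmetric])
      then show ?thesis
        using L2_integral_add_square[OF L2_cell_diff[OF LG(1) L2u] L2_cell_R_perp[OF L2_cell_diff[OF LG(2) L2v]], of n n]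
        by (simp add: norm_R_perp)
    qed
    ultimately show ?thesis by (simp add: a_def norm_minus_commute)
  qed
  moreover have "?b \<longlonglongrightarrow> 4 * 0 + 4 * 0 + 2 * 0"
    by (intro tendsto_intros 1(3) 2(3) a0)
  ultimately have "(LINT x|cell_measure. (norm (f x - H x))\<^sup>2) \<le> 0"
    by (intro LIMSEQ_le_const[of ?b]) auto
  then have "(LINT x|cell_measure. (norm (f x - H x))\<^sup>2) = 0"
    by (intro antisym) auto
  then have "AE x in cell_measure. (norm (f x - H x))\<^sup>2 = 0"
    using L2_cell_diff[OF L2f LH] by (subst (asm) integral_nonneg_eq_0_iff_AE) (auto simp: L2_cell_def)
  then have "AE x in cell_measure. f x = G1 x + R_perp *v G2 x"
    by eventually_elim (simp add: H_def)
  then show thesis using that 1 2 by blast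
qed

section \<open>The operators and their inverses\<close>

lemma matrix_inv_mult_vector:
  fixes A :: "real^'n^'n"
  assumes "invertible A"
  shows "A *v (matrix_inv A *v v) = v" "matrix_inv A *v (A *v v) = v"
proof -
  have "A ** matrix_inv A = mat 1 \<and> matrix_inv A ** A = mat 1"
    using assms unfolding invertible_def matrix_inv_def by (rule someI_ex)
  then show "A *v (matrix_inv A *v v) = v" "matrix_inv A *v (A *v v) = v"
    by (simp_all add: matrix_vector_mul_assoc)
qed

text \<open>The adjugate formula exhibits the entries of the inverse as rational functions of the
  entries of A, from which measurability of the inverse field follows.\<close>

lemma matrix_inv_2:
  fixes A :: "real^2^2"
  assumes "invertible A"
  shows "matrix_inv A = (1 / det A) *\<^sub>R vector [vector [A $ 2 $ 2, - (A $ 1 $ 2)], vector [- (A $ 2 $ 1), A $ 1 $ 1]]"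
    (is "_ = ?B")
proof -
  have d: "A $ 1 $ 1 * A $ 2 $ 2 - A $ 1 $ 2 * A $ 2 $ 1 \<noteq> 0"
    using assms by (simp add: invertible_det_nz det_2)
  have "A *v (?B *v v) = v" for v
    using d by (simp add: vec_eq_iff forall_2 matrix_vector_mult_def sum_2 det_2 divide_simps) (simp add: algebra_simps)
  then have "matrix_inv A *v v = ?B *v v" for v
    by (metis matrix_inv_mult_vector(2)[OF assms])
  then show ?thesis by (simp add: matrix_eq)
qed

lemma symmetric_matrix_inner:
  fixes A :: "real^'n^'n"
  shows "transpose A = A \<Longrightarrow> (A *v v) \<bullet> w = v \<bullet> (A *v w)"
  by (metis dot_lmul_matrix vector_transpose_matrix)

lemma invertible_pos_def:
  fixes A :: "real^'n^'n"
  assumes "\<And>v. v \<noteq> 0 \<Longrightarrow> 0 < v \<bullet> (A *v v)"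
  shows "invertible A"
  unfolding invertible_left_inverse matrix_left_invertible_ker
  using assms by (metis inner_zero_right less_irrefl)

section \<open>The condition L > 1/2 I_2 expressed through the inverse matrix\<close>

context
  fixes L :: "real^2^2"
  assumes sym: "transpose L = L" and half: "qf_less ((1/2) *\<^sub>R mat 1) L"
begin

lemma half_less_form: "v \<noteq> 0 \<Longrightarrow> 1/2 * (v \<bullet> v) < v \<bullet> (L *v v)"
  using half by (auto simp: qf_less_def scaleR_matrix_vector_assoc[symmetric])

lemma invertible_half: "invertible L"
proof (rule invertible_pos_def)
  fix v :: "real^2" assume "v \<noteq> 0"
  then show "0 < v \<bullet> (L *v v)" using half_less_form[of v] inner_ge_zero[of v] by linarith
qed

lemma matrix_inv_half_bounds:
  assumes "y \<noteq> 0"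
  shows "0 < y \<bullet> (matrix_inv L *v y)" "y \<bullet> (matrix_inv L *v y) < 2 * (y \<bullet> y)"
proof -
  define w where "w = matrix_inv L *v y"
  have y: "y = L *v w" by (simp add: w_def matrix_inv_mult_vector invertible_half)
  then have "w \<noteq> 0" using assms by auto
  then have 1: "1/2 * (w \<bullet> w) < y \<bullet> w" using half_less_form[of w] y by (simp add: inner_commute)
  then show "0 < y \<bullet> (matrix_inv L *v y)" using inner_ge_zero[of w] unfolding w_def[symmetric] by linarith
  \<comment> \<open>Expanding gives 4 (y . w) \<le> 4 |y|^2 + |w|^2, and the last term is below 2 (y
    . w) by the bound on L.\<close>
  have "0 \<le> (2 *\<^sub>R y - w) \<bullet> (2 *\<^sub>R y - w)" by simp
  then have "4 * (y \<bullet> w) \<le> 4 * (y \<bullet> y) + w \<bullet> w" by (simp add: inner_diff inner_commute)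
  then show "y \<bullet> (matrix_inv L *v y) < 2 * (y \<bullet> y)" using 1 by (simp add: w_def[symmetric])
qed

text \<open>With w the image of y, |w|^2 / 2 \<le> y . w \<le> |y| |w|. This uniform bound makes the
  entries of the inverse integrable and L^{-1} j_0 bounded.\<close>

lemma norm_matrix_inv_half: "norm (matrix_inv L *v y) \<le> 2 * norm y"
proof (cases "matrix_inv L *v y = 0")
  case False
  define w where "w = matrix_inv L *v y"
  have y: "L *v w = y" by (simp add: w_def matrix_inv_mult_vector invertible_half)
  have "1/2 * (norm w * norm w) \<le> y \<bullet> w"
    using half_less_form[of w] y False
    by (simp add: inner_commute w_def[symmetric] less_imp_le flip: power2_eq_square power2_norm_eq_inner)
  also have "\<dots> \<le> norm y * norm w" by (rule norm_cauchy_schwarz)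
  finally have "(1/2 * norm w) * norm w \<le> norm y * norm w" by simp
  then show ?thesis using False by (simp add: w_def[symmetric])
qed simp

lemma matrix_inv_half_symmetric: "(matrix_inv L *v x) \<bullet> y = x \<bullet> (matrix_inv L *v y)"
  using symmetric_matrix_inner[OF sym, of "matrix_inv L *v x" "matrix_inv L *v y"]
  by (simp add: matrix_inv_mult_vector invertible_half)

end

section \<open>Blocks, flux and positivity of \<open>frakL\<close>\<close>

lemma transpose_R_perp: "transpose R_perp = - R_perp"
  by (simp add: vec_eq_iff forall_2 R_perp_def transpose_def)

lemma minus_matrix_vector_mult: "(- A) *v v = - (A *v (v::real^'n))" for A :: "real^'n^'m"
  by (simp add: vec_eq_iff matrix_vector_mult_def sum_negf)

text \<open>\<open>R_perp\<close> has zero diagonal, so \<open>T_op\<close> changes only the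
  off-diagonal blocks, by -R and R.\<close>

lemma frakL_entries:
  "frakL L R_perp $ 1 $ 1 = L"
  "frakL L R_perp $ 1 $ 2 = L ** R_perp - R_perp"
  "frakL L R_perp $ 2 $ 1 = transpose R_perp ** L + R_perp"
  "frakL L R_perp $ 2 $ 2 = transpose R_perp ** L ** R_perp"
  by (simp_all add: frakL_def T_op_def block_tensor_def, simp_all add: R_perp_def)

lemma block_app_frakL:
  "block_app (frakL L R_perp) E $ 1 = L *v (E $ 1 + R_perp *v E $ 2) - R_perp *v E $ 2"
  "block_app (frakL L R_perp) E $ 2 = - (R_perp *v (L *v (E $ 1 + R_perp *v E $ 2))) + R_perp *v E $ 1"
  by (simp_all add: block_app_def sum_2 frakL_entries matrix_vector_mult_add_rdistrib
      matrix_vector_mult_diff_rdistrib matrix_vector_right_distrib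
      transpose_R_perp minus_matrix_vector_mult flip: matrix_vector_mul_assoc)

lemma block_app_frakL_inner:
  "block_app (frakL L R_perp) E \<bullet> F = (L *v (E $ 1 + R_perp *v E $ 2)) \<bullet> (F $ 1 + R_perp *v F $ 2)
    + (R_perp *v E $ 1) \<bullet> F $ 2 - (R_perp *v E $ 2) \<bullet> F $ 1"
  by (simp add: inner_vec_def[of E] inner_vec_def[of "block_app _ _"] sum_2 block_app_frakL inner_add inner_diff R_perp_inner)

text \<open>The variables e = E_1 + R E_2 and d = E_1 - R E_2 separate the form into e . (L - 1/2) e
  + |d|^2 / 2. The assumptions are phrased by inner products so that the lemma serves both L x and
  the homogenized matrix.\<close>

lemma frakL_Sym_pos:
  assumes sym: "\<And>v w. (L *v v) \<bullet> w = v \<bullet> (L *v w)" and half: "\<And>v. v \<noteq> 0 \<Longrightarrow> 1/2 * (v \<bullet> v) < v \<bullet> (L *v v)"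
  shows "frakL L R_perp \<in> Sym_pos"
  unfolding Sym_pos_def
proof (intro CollectI conjI allI impI)
  fix E F :: field_space
  have "(L *v (E $ 1 + R_perp *v E $ 2)) \<bullet> (F $ 1 + R_perp *v F $ 2)
      = (L *v (F $ 1 + R_perp *v F $ 2)) \<bullet> (E $ 1 + R_perp *v E $ 2)"
    by (subst sym) (rule inner_commute)
  then show "block_app (frakL L R_perp) E \<bullet> F = E \<bullet> block_app (frakL L R_perp) F"
    unfolding inner_commute[of E "block_app (frakL L R_perp) F"] block_app_frakL_inner
    using R_perp_inner[of "E $ 1" "F $ 2"] R_perp_inner[of "E $ 2" "F $ 1"]
      inner_commute[of "E $ 1"] inner_commute[of "E $ 2"] by simp
next
  fix E :: field_space assume "E \<noteq> 0"
  define e where "e = E $ 1 + R_perp *v E $ 2"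
  define d where "d = E $ 1 - R_perp *v E $ 2"
  have RR: "(R_perp *v v) \<bullet> (R_perp *v v) = v \<bullet> v" for v by (simp add: R_perp_mult inner_real2)
  have "d \<bullet> d = E $ 1 \<bullet> E $ 1 + E $ 2 \<bullet> E $ 2 - 2 * (E $ 1 \<bullet> (R_perp *v E $ 2))"
    "e \<bullet> e = E $ 1 \<bullet> E $ 1 + E $ 2 \<bullet> E $ 2 + 2 * (E $ 1 \<bullet> (R_perp *v E $ 2))"
    by (simp_all add: d_def e_def inner_add inner_diff inner_commute RR)
  moreover have "(R_perp *v E $ 1) \<bullet> E $ 2 = - (E $ 1 \<bullet> (R_perp *v E $ 2))"
    by (rule R_perp_inner)
  moreover have "(R_perp *v E $ 2) \<bullet> E $ 1 = E $ 1 \<bullet> (R_perp *v E $ 2)"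
    by (rule inner_commute)
  ultimately have "(R_perp *v E $ 1) \<bullet> E $ 2 - (R_perp *v E $ 2) \<bullet> E $ 1 = 1/2 * (d \<bullet> d) - 1/2 * (e \<bullet> e)"
    by linarith
  then have form: "E \<bullet> block_app (frakL L R_perp) E = e \<bullet> (L *v e) - 1/2 * (e \<bullet> e) + 1/2 * (d \<bullet> d)"
    unfolding inner_commute[of E "block_app (frakL L R_perp) E"] block_app_frakL_inner e_def[symmetric]
      inner_commute[of "L *v e" e] by linarith
  show "0 < E \<bullet> block_app (frakL L R_perp) E"
  proof (cases "e = 0")
    case False
    then show ?thesis using half[of e] inner_ge_zero[of d] unfolding form by linarith
  next
    case True
    then have e1: "E $ 1 = - (R_perp *v E $ 2)" by (simp add: e_def add_eq_0_iff2)
    \<comment> \<open>(e, d) determines E because R is an isometry, so both cannot vanish.\<close>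
    have "d \<noteq> 0"
    proof
      assume "d = 0"
      then have e2: "E $ 1 = R_perp *v E $ 2" by (simp add: d_def)
      with e1 have "2 *\<^sub>R (R_perp *v E $ 2) = 0" by (metis add.right_inverse scaleR_2)
      then have R0: "R_perp *v E $ 2 = 0" by (simp only: scaleR_eq_0_iff) simp
      with e2 have "E $ 1 = 0" by simp
      from R0 have "E $ 2 = 0" using norm_R_perp[of "E $ 2"] by simp
      with \<open>E $ 1 = 0\<close> have "E = 0" by (simp add: vec_eq_iff[of E] forall_2)
      with \<open>E \<noteq> 0\<close> show False by blast
    qed
    then have "0 < d \<bullet> d" by simp
    then show ?thesis unfolding form True by simp
  qed
qed

section \<open>Measurability and integrability of vector and matrix fields\<close>

lemma bounded_linear_axis: "bounded_linear (axis i :: 'b::euclidean_space \<Rightarrow> 'b^2)"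
  by (intro linear_conv_bounded_linear[THEN iffD1] linearI) (auto simp: vec_eq_iff axis_def)

lemma vec2_eq_axis: "(v :: 'b::euclidean_space^2) = axis 1 (v $ 1) + axis 2 (v $ 2)"
  by (simp add: vec_eq_iff forall_2 axis_def)

lemma integrable_vec2:
  fixes f :: "'a \<Rightarrow> 'b::euclidean_space^2"
  assumes "\<And>i. integrable M (\<lambda>x. f x $ i)"
  shows "integrable M f"
proof -
  have "f = (\<lambda>x. axis 1 (f x $ 1) + axis 2 (f x $ 2) :: 'b^2)" by (simp flip: vec2_eq_axis)
  moreover have "integrable M (\<lambda>x. axis 1 (f x $ 1) + axis 2 (f x $ 2) :: 'b^2)"
    by (intro Bochner_Integration.integrable_add integrable_bounded_linear[OF bounded_linear_axis] assms)
  ultimately show ?thesis by simp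
qed

lemma borel_measurable_vec2:
  fixes f :: "'a \<Rightarrow> 'b::euclidean_space^2"
  assumes "\<And>i. (\<lambda>x. f x $ i) \<in> borel_measurable M"
  shows "f \<in> borel_measurable M"
proof -
  have "axis i \<in> borel_measurable (borel :: 'b measure)" for i :: 2
    by (intro borel_measurable_continuous_onI linear_continuous_on bounded_linear_axis)
  then have "(\<lambda>x. axis i (f x $ i)) \<in> borel_measurable M" for i
    using assms measurable_compose by blast
  then have "(\<lambda>x. axis 1 (f x $ 1) + axis 2 (f x $ 2) :: 'b^2) \<in> borel_measurable M"
    by (intro borel_measurable_add)
  then show ?thesis by (simp flip: vec2_eq_axis)
qed

lemma borel_measurable_nth2:
  fixes f :: "'a \<Rightarrow> 'b::euclidean_space^2"
  assumes "f \<in> borel_measurable M"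
  shows "(\<lambda>x. f x $ i) \<in> borel_measurable M"
  using assms by (rule measurable_compose)
    (intro borel_measurable_continuous_onI linear_continuous_on bounded_linear_vec_nth)

lemma borel_measurable_matrix_vector:
  fixes A :: "'a \<Rightarrow> real^2^2"
  assumes "A \<in> borel_measurable M" "v \<in> borel_measurable M"
  shows "(\<lambda>x. A x *v v x) \<in> borel_measurable M"
proof (rule borel_measurable_vec2)
  fix i
  note m = borel_measurable_nth2[OF borel_measurable_nth2[OF assms(1)]] borel_measurable_nth2[OF assms(2)]
  show "(\<lambda>x. (A x *v v x) $ i) \<in> borel_measurable M"
    unfolding matrix_vector_mult_def sum_2 vec_lambda_beta using m by measurable
qed

lemma bounded_linear_matrix_vector_left: "bounded_linear (\<lambda>A::real^2^2. A *v v)"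
  by (intro linear_conv_bounded_linear[THEN iffD1] linearI)
    (simp_all add: matrix_vector_mult_add_rdistrib scaleR_matrix_vector_assoc)

text \<open>Strictness survives averaging since the cell has positive measure; it gives both strict
  bounds on the averaged inverse.\<close>

lemma integral_cell_pos:
  fixes h :: "real^2 \<Rightarrow> real"
  assumes "integrable cell_measure h" "\<And>x. 0 < h x"
  shows "0 < (LINT x|cell_measure. h x)"
proof -
  have "(LINT x|cell_measure. h x) \<noteq> 0"
  proof
    assume "(LINT x|cell_measure. h x) = 0"
    then have "AE x in cell_measure. h x = 0"
      using assms by (subst (asm) integral_nonneg_eq_0_iff_AE) (auto intro: less_imp_le)
    then have "AE x in cell_measure. False"
      by eventually_elim (metis assms(2) less_irrefl)
    then have "emeasure cell_measure (space cell_measure) = 0"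
      by (simp add: AE_iff_measurable[OF _ refl])
    then show False using measure_cell by (simp add: measure_def)
  qed
  moreover have "0 \<le> (LINT x|cell_measure. h x)"
    using assms(2) by (intro Bochner_Integration.integral_nonneg) (auto intro: less_imp_le)
  ultimately show ?thesis by simp
qed

text \<open>Testing with the constant field equal to the mean of G itself gives that the square of
  the mean is 0.\<close>

lemma H1_per_grad_integral_zero:
  assumes "H1_per_grad \<phi> G"
  shows "(LINT x|cell_measure. G x) = 0"
proof -
  have "integrable cell_measure G" using assms by (intro integrable_L2) (simp add: H1_per_grad_def)
  then have "(LINT x|cell_measure. G x) \<bullet> (LINT x|cell_measure. G x) = 0"
    using div_free_orthogonal_H1_per_grad[OF div_free_const assms, of "LINT x|cell_measure. G x"]
    by simp
  then show ?thesis by simp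
qed

lemma div_free_affine:
  assumes "div_free J"
  shows "div_free (\<lambda>x. c + s *\<^sub>R J x)"
proof -
  have L: "L2_cell (\<lambda>x. s *\<^sub>R J x)"
    using assms by (intro L2_cell_linear[OF _ bounded_linear_scaleR_right]) (simp add: div_free_def)
  have "(LINT x|cell_measure. (c + s *\<^sub>R J x) \<bullet> grad \<psi> x) = 0" if "\<psi> \<in> smooth_per" for \<psi>
  proof -
    have J: "integrable cell_measure (\<lambda>x. J x \<bullet> grad \<psi> x)" "(LINT x|cell_measure. J x \<bullet> grad \<psi> x) = 0"
      using assms that by (auto simp: div_free_def intro: integrable_L2_inner L2_cell_grad)
    then show ?thesis
      using integrable_L2_inner[OF L2_cell_const[of c] L2_cell_grad[OF that]] integral_cell_const_inner_grad[OF that, of c]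
      by (simp add: inner_add_left)
  qed
  then show ?thesis
    using assms L2_cell_add[OF L2_cell_const[of c] L] by (simp add: div_free_def cell_periodic_def)
qed

text \<open>Square integrability and the weak equation ignore null sets, while periodicity holds at
  every point and has to be supplied for J'.\<close>

lemma div_free_AE_cong:
  assumes J: "div_free J" and J': "J' \<in> borel_measurable cell_measure" "cell_periodic J'"
    and eq: "AE x in cell_measure. J' x = J x"
  shows "div_free J'"
proof -
  have [measurable]: "J \<in> borel_measurable cell_measure" using J by (simp add: div_free_def L2_cell_def)
  have "integrable cell_measure (\<lambda>x. (norm (J x))\<^sup>2)" using J by (simp add: div_free_def L2_cell_def)
  then have "integrable cell_measure (\<lambda>x. (norm (J' x))\<^sup>2)"
    by (rule integrable_cong_AE_imp) (use J'(1) eq in \<open>auto elim!: eventually_mono\<close>)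
  then have "L2_cell J'" using J'(1) by (simp add: L2_cell_def)
  moreover have "(LINT x|cell_measure. J' x \<bullet> grad \<psi> x) = 0" if "\<psi> \<in> smooth_per" for \<psi>
  proof -
    have [measurable]: "grad \<psi> \<in> borel_measurable cell_measure" by (intro L2_cell_measurable L2_cell_grad that)
    have "(LINT x|cell_measure. J' x \<bullet> grad \<psi> x) = (LINT x|cell_measure. J x \<bullet> grad \<psi> x)"
      using J'(1) eq by (intro integral_cong_AE) (auto elim!: eventually_mono)
    then show ?thesis using J that by (simp add: div_free_def)
  qed
  ultimately show ?thesis using J'(2) by (simp add: div_free_def)
qed

text \<open>The difference D of two solutions consists of H^1 gradients and its flux is
  divergence-free, so the energy D . A D integrates to 0. Being nonnegative, it vanishes almost
  everywhere, and pointwise positivity forces D = 0 there.\<close>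

lemma cell_field_unique_AE:
  assumes pos: "\<And>x. A x \<in> Sym_pos" and E: "cell_field A E0 E" and E': "cell_field A E0 E'"
  shows "AE x in cell_measure. E' x = E x"
proof -
  obtain \<phi> G where G: "\<And>i. H1_per_grad (\<phi> i) (G i)" "E = (\<lambda>x. E0 + (\<chi> i. G i x))"
    and J: "\<And>i. div_free (\<lambda>x. block_app (A x) (E x) $ i)"
    using E unfolding cell_field_def by blast
  obtain \<phi>' G' where G': "\<And>i. H1_per_grad (\<phi>' i) (G' i)" "E' = (\<lambda>x. E0 + (\<chi> i. G' i x))"
    and J': "\<And>i. div_free (\<lambda>x. block_app (A x) (E' x) $ i)"
    using E' unfolding cell_field_def by blast
  let ?J = "\<lambda>i x. block_app (A x) (E x) $ i" and ?J' = "\<lambda>i x. block_app (A x) (E' x) $ i"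
  define D where "D x = E' x - E x" for x
  have D: "D x $ i = G' i x - G i x" for x i by (simp add: D_def G(2) G'(2))
  have app: "block_app (A x) (D x) $ i = ?J' i x - ?J i x" for x i
    by (simp add: D_def block_app_def matrix_vector_mult_diff_distrib sum_subtractf)
  have L2: "L2_cell (G i)" "L2_cell (G' i)" "L2_cell (?J i)" "L2_cell (?J' i)" for i
    using G(1) G'(1) J J' by (auto simp: H1_per_grad_def div_free_def)
  have z: "(LINT x|cell_measure. (?J' i x - ?J i x) \<bullet> (G' i x - G i x)) = 0" for i
    by (simp add: inner_diff_left inner_diff_right integrable_L2_inner L2
        div_free_orthogonal_H1_per_grad[OF J G(1)] div_free_orthogonal_H1_per_grad[OF J' G(1)]
        div_free_orthogonal_H1_per_grad[OF J G'(1)] div_free_orthogonal_H1_per_grad[OF J' G'(1)])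
  have int: "integrable cell_measure (\<lambda>x. (?J' i x - ?J i x) \<bullet> (G' i x - G i x))" for i
    by (intro integrable_L2_inner L2_cell_diff L2)
  have eq: "D x \<bullet> block_app (A x) (D x) = (?J' 1 x - ?J 1 x) \<bullet> (G' 1 x - G 1 x) + (?J' 2 x - ?J 2 x) \<bullet> (G' 2 x - G 2 x)" for x
    by (simp add: inner_vec_def[of "D x"] sum_2 app D inner_commute)
  have pos': "D x \<noteq> 0 \<Longrightarrow> 0 < D x \<bullet> block_app (A x) (D x)" for x
    using pos[of x] by (simp add: Sym_pos_def)
  have nn: "0 \<le> D x \<bullet> block_app (A x) (D x)" for x
    using pos'[of x] by (cases "D x = 0") (auto intro: less_imp_le)
  have "integrable cell_measure (\<lambda>x. D x \<bullet> block_app (A x) (D x))"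
    unfolding eq by (intro Bochner_Integration.integrable_add int)
  moreover have "(LINT x|cell_measure. D x \<bullet> block_app (A x) (D x)) = 0"
    unfolding eq by (simp add: int z)
  ultimately have "AE x in cell_measure. D x \<bullet> block_app (A x) (D x) = 0"
    using nn by (subst (asm) integral_nonneg_eq_0_iff_AE) auto
  then show ?thesis
    by eventually_elim (metis D_def eq_iff_diff_eq_0 less_irrefl pos')
qed

section \<open>The effective tensor\<close>

lemma frakL_has_effective_tensor:
  fixes L :: "real^2 \<Rightarrow> real^2^2"
  assumes per: "cell_periodic L" and meas: "L \<in> borel_measurable cell_measure"
    and sym: "\<And>x. transpose (L x) = L x"
    and half: "\<And>x. qf_less ((1/2) *\<^sub>R mat 1) (L x)"
  defines "N \<equiv> LINT x|cell_measure. matrix_inv (L x)"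
  shows "integrable cell_measure (\<lambda>x. matrix_inv (L x))" "invertible N"
    "(\<lambda>x. frakL (L x) R_perp) has_effective_tensor frakL (matrix_inv N) R_perp"
proof -
  define K where "K x = matrix_inv (L x)" for x
  note inv = invertible_half[OF sym half]
  note L_half = half_less_form[OF sym half]
  note K_bounds = matrix_inv_half_bounds[OF sym half, folded K_def]
  note K_norm = norm_matrix_inv_half[OF sym half, folded K_def]
  note K_sym = matrix_inv_half_symmetric[OF sym half, folded K_def]
  have LK: "L x *v (K x *v v) = v" for x v unfolding K_def by (rule matrix_inv_mult_vector[OF inv])
  have Km: "K \<in> borel_measurable cell_measure"
  proof -
    have e: "(\<lambda>x. L x $ i $ j) \<in> borel_measurable cell_measure" for i j
      by (intro borel_measurable_nth2 meas)
    have "(\<lambda>x. K x $ i $ j) \<in> borel_measurable cell_measure" for i j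
      using e exhaust_2[of i] exhaust_2[of j]
      by (auto simp: K_def matrix_inv_2[OF inv] det_2)
    then show ?thesis by (intro borel_measurable_vec2)
  qed
  have Kint: "integrable cell_measure K"
  proof (intro integrable_vec2 integrable_cell_bounded[where B=2])
    show "(\<lambda>x. K x $ i $ j) \<in> borel_measurable cell_measure" for i j by (intro borel_measurable_nth2 Km)
    show "norm (K x $ i $ j) \<le> 2" for x i j
    proof -
      have "K x $ i $ j = (K x *v axis j 1) $ i" by (simp add: matrix_vector_mul_component inner_axis)
      then have "\<bar>K x $ i $ j\<bar> \<le> norm (K x *v axis j 1)" by (simp add: component_le_norm_cart)
      also have "\<dots> \<le> 2" using K_norm[of x "axis j 1"] by simp
      finally show ?thesis by simp
    qed
  qed
  then show "integrable cell_measure (\<lambda>x. matrix_inv (L x))" by (simp add: K_def[abs_def])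
  have NK: "N = (LINT x|cell_measure. K x)" by (simp add: N_def K_def)
  have Kv: "integrable cell_measure (\<lambda>x. K x *v v)" for v
    by (rule integrable_bounded_linear[OF bounded_linear_matrix_vector_left Kint])
  have Nv: "N *v v = (LINT x|cell_measure. K x *v v)" for v
    unfolding NK by (rule integral_bounded_linear[OF bounded_linear_matrix_vector_left Kint, symmetric])
  have Nform: "v \<bullet> (N *v w) = (LINT x|cell_measure. v \<bullet> (K x *v w))" for v w
    unfolding Nv by (rule integral_inner_right[symmetric]) (rule Kv)
  have N_pos: "0 < v \<bullet> (N *v v)" if "v \<noteq> 0" for v
    unfolding Nform by (intro integral_cell_pos K_bounds(1) that integrable_inner_right Kv)
  \<comment> \<open>Averages the upper bound on each inverse; strictness is kept because
    \<open>Ls_half\<close> needs a strict inequality.\<close>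
  have N_less: "v \<bullet> (N *v v) < 2 * (v \<bullet> v)" if "v \<noteq> 0" for v
  proof -
    have "0 < (LINT x|cell_measure. 2 * (v \<bullet> v) - v \<bullet> (K x *v v))"
      using K_bounds(2)[OF that] by (intro integral_cell_pos Bochner_Integration.integrable_diff
          integrable_inner_right Kv integrable_cell_continuous[OF continuous_on_const]) auto
    also have "\<dots> = 2 * (v \<bullet> v) - v \<bullet> (N *v v)"
      unfolding Nform by (subst Bochner_Integration.integral_diff)
        (auto simp: integral_cell_const simp del: lebesgue_integral_const intro!: integrable_inner_right Kv integrable_cell_continuous[OF continuous_on_const])
    finally show ?thesis by simp
  qed
  have N_sym: "(N *v v) \<bullet> w = v \<bullet> (N *v w)" for v w
  proof -
    have "w \<bullet> (K x *v v) = v \<bullet> (K x *v w)" for x by (subst inner_commute) (rule K_sym)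
    then show ?thesis unfolding inner_commute[of "N *v v" w] Nform by simp
  qed
  show Ninv: "invertible N" by (rule invertible_pos_def[OF N_pos])
  define Ls where "Ls = matrix_inv N"
  have NLs: "N *v (Ls *v v) = v" for v unfolding Ls_def by (rule matrix_inv_mult_vector[OF Ninv])
  have Ls_sym: "(Ls *v v) \<bullet> w = v \<bullet> (Ls *v w)" for v w
    using N_sym[of "Ls *v v" "Ls *v w"] by (simp add: NLs)
  have Ls_half: "1/2 * (v \<bullet> v) < v \<bullet> (Ls *v v)" if "v \<noteq> 0" for v
  proof -
    define w where "w = Ls *v v"
    \<comment> \<open>\<open>v \<bullet> N\<^sup>-\<^sup>1 v \<ge> 2 v \<bullet> y - y \<bullet> N y\<close> for every \<open>y\<close>; take \<open>y = v / 2\<close>.\<close>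
    define z where "z = w - (1/2) *\<^sub>R v"
    have Nw: "N *v w = v" unfolding w_def by (rule NLs)
    then have wNv: "w \<bullet> (N *v v) = v \<bullet> v" using N_sym[of w v] by simp
    have "0 \<le> z \<bullet> (N *v z)" using N_pos[of z] by (cases "z = 0") auto
    also have "\<dots> = v \<bullet> w - v \<bullet> v + 1/4 * (v \<bullet> (N *v v))"
      by (simp add: z_def inner_diff matrix_vector_mult_diff_distrib matrix_vector_mult_scaleR
          Nw wNv inner_commute diff_divide_distrib)
    finally show ?thesis using N_less[OF that] unfolding w_def by linarith
  qed
  have Spos: "frakL (L x) R_perp \<in> Sym_pos" for x
    by (intro frakL_Sym_pos symmetric_matrix_inner sym L_half)
  have solution: "\<exists>E. cell_field (\<lambda>x. frakL (L x) R_perp) E0 E \<and>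
      block_app (frakL Ls R_perp) E0 = (LINT x|cell_measure. block_app (frakL (L x) R_perp) (E x))" for E0
  proof -
    define e0 where "e0 = E0 $ 1 + R_perp *v E0 $ 2"
    define j0 where "j0 = Ls *v e0"
    define f where "f x = K x *v j0 - e0" for x
    have fm: "f \<in> borel_measurable cell_measure"
      unfolding f_def by (intro borel_measurable_diff borel_measurable_matrix_vector Km) auto
    have fB: "norm (f x) \<le> 2 * norm j0 + norm e0" for x
      unfolding f_def using norm_triangle_ineq4[of "K x *v j0" e0] K_norm[of x j0] by linarith
    have f0: "(LINT x|cell_measure. f x) = 0"
      unfolding f_def by (subst Bochner_Integration.integral_diff)
        (auto simp: Kv Nv[symmetric] j0_def NLs integral_cell_const simp del: lebesgue_integral_const intro: integrable_cell_continuous[OF continuous_on_const])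
    obtain \<phi>1 G1 \<phi>2 G2 where G1: "H1_per_grad \<phi>1 G1" "div_free (\<lambda>x. R_perp *v G1 x)"
      and G2: "H1_per_grad \<phi>2 G2" "div_free (\<lambda>x. R_perp *v G2 x)"
      and fG: "AE x in cell_measure. f x = G1 x + R_perp *v G2 x"
      by (rule helmholtz_decomposition[OF fm fB f0])
    define \<phi> where "\<phi> i = (if i = 1 then \<phi>1 else \<phi>2)" for i :: 2
    define G where "G i = (if i = 1 then G1 else G2)" for i :: 2
    define E where "E = (\<lambda>x. E0 + (\<chi> i. G i x))"
    have E12: "E x $ 1 = E0 $ 1 + G1 x" "E x $ 2 = E0 $ 2 + G2 x" for x by (simp_all add: E_def G_def)
    have L2: "L2_cell G1" "L2_cell G2" "cell_periodic G1" "cell_periodic G2"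
      using G1(1) G2(1) by (auto simp: H1_per_grad_def)
    let ?J = "\<lambda>x. block_app (frakL (L x) R_perp) (E x)"
    \<comment> \<open>The flux predicted by L e = j0. It is divergence-free because the
      decomposition provides R G1 and R G2 as such; the signs appear as scalar factors to fit
      \<open>div_free_affine\<close>.\<close>
    define J where "J i = (if i = 1 then (\<lambda>x. (j0 - R_perp *v E0 $ 2) + (-1) *\<^sub>R (R_perp *v G2 x))
        else (\<lambda>x. (- (R_perp *v j0) + R_perp *v E0 $ 1) + 1 *\<^sub>R (R_perp *v G1 x)))" for i :: 2
    have Jdf: "div_free (J i)" for i
    proof (cases "i = 1")
      case True
      show ?thesis unfolding J_def if_P[OF True] by (rule div_free_affine[OF G2(2)])
    next
      case False
      show ?thesis unfolding J_def if_not_P[OF False] by (rule div_free_affine[OF G1(2)])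
    qed
    \<comment> \<open>Where the decomposition holds, e = e0 + f x = K x j0, and L x sends this to
      j0.\<close>
    have JE: "AE x in cell_measure. ?J x $ i = J i x" for i
      using fG
    proof eventually_elim
      case (elim x)
      have "E x $ 1 + R_perp *v E x $ 2 = e0 + f x"
        unfolding elim by (simp add: E12 e0_def matrix_vector_right_distrib)
      then have "L x *v (E x $ 1 + R_perp *v E x $ 2) = j0" by (simp add: f_def LK)
      then show ?case
        using exhaust_2[of i] by (auto simp: block_app_frakL J_def E12 matrix_vector_right_distrib)
    qed
    have Jm: "(\<lambda>x. ?J x $ i) \<in> borel_measurable cell_measure" for i
    proof -
      have m: "(\<lambda>x. E x $ i) \<in> borel_measurable cell_measure" for i
        using exhaust_2[of i] L2(1,2)[THEN L2_cell_measurable] by (auto simp: E12)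
      have R: "(\<lambda>x. R_perp *v h x) \<in> borel_measurable cell_measure" if "h \<in> borel_measurable cell_measure" for h
        using that by (intro borel_measurable_matrix_vector) auto
      have "(\<lambda>x. ?J x $ 1) \<in> borel_measurable cell_measure" "(\<lambda>x. ?J x $ 2) \<in> borel_measurable cell_measure"
        unfolding block_app_frakL
        by (intro borel_measurable_diff borel_measurable_add borel_measurable_uminus borel_measurable_matrix_vector R meas m)+
      then show ?thesis using exhaust_2[of i] by auto
    qed
    have Eper: "cell_periodic E"
      using L2 unfolding cell_periodic_def E_def G_def by auto
    have "div_free (\<lambda>x. ?J x $ i)" for i
      by (rule div_free_AE_cong[OF Jdf Jm _ JE]) (use per Eper in \<open>simp add: cell_periodic_def\<close>)
    moreover have "H1_per_grad (\<phi> i) (G i)" for i using G1(1) G2(1) by (simp add: \<phi>_def G_def)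
    ultimately have cf: "cell_field (\<lambda>x. frakL (L x) R_perp) E0 E"
      unfolding cell_field_def by (intro conjI exI[of _ \<phi>] exI[of _ G] allI) (auto simp: E_def)
    have Jint: "integrable cell_measure (J i)" for i
      using Jdf[of i] by (intro integrable_L2) (simp add: div_free_def)
    have Jint': "integrable cell_measure (\<lambda>x. ?J x $ i)" for i
      using JE[of i] by (intro integrable_cong_AE_imp[OF Jint[of i] Jm]) (auto elim: eventually_mono)
    have comp: "(LINT x|cell_measure. ?J x) $ i = (LINT x|cell_measure. J i x)" for i
    proof -
      have "(LINT x|cell_measure. ?J x) $ i = (LINT x|cell_measure. ?J x $ i)"
        by (rule integral_bounded_linear[OF bounded_linear_vec_nth, symmetric]) (intro integrable_vec2 Jint')
      also have "\<dots> = (LINT x|cell_measure. J i x)"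
        using Jint Jm JE by (intro integral_cong_AE) auto
      finally show ?thesis .
    qed
    have RG: "(LINT x|cell_measure. c + s *\<^sub>R (R_perp *v G' x)) = c" if "H1_per_grad \<phi>' G'" for c s \<phi>' G'
    proof -
      have i: "integrable cell_measure G'" using that by (intro integrable_L2) (simp add: H1_per_grad_def)
      have "(LINT x|cell_measure. R_perp *v G' x) = R_perp *v (LINT x|cell_measure. G' x)"
        by (rule integral_bounded_linear[OF matrix_vector_mul_bounded_linear i])
      then show ?thesis
        using integrable_bounded_linear[OF matrix_vector_mul_bounded_linear[of R_perp] i] H1_per_grad_integral_zero[OF that]
        by (subst Bochner_Integration.integral_add)
          (auto simp: integral_cell_const simp del: lebesgue_integral_const intro: integrable_cell_continuous[OF continuous_on_const])
    qed
    have J1: "(LINT x|cell_measure. J 1 x) = j0 - R_perp *v E0 $ 2"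
      unfolding J_def if_P[OF refl] by (rule RG[OF G2(1)])
    have "(2::2) \<noteq> 1" by simp
    then have J2: "(LINT x|cell_measure. J 2 x) = - (R_perp *v j0) + R_perp *v E0 $ 1"
      unfolding J_def by (simp only: if_False RG[OF G1(1)])
    \<comment> \<open>The averaged fluxes are the flux formula for \<open>frakL Ls R_perp\<close> at
      E0, since Ls e0 = j0.\<close>
    have "block_app (frakL Ls R_perp) E0 = (LINT x|cell_measure. ?J x)"
      by (simp add: vec_eq_iff[of "block_app _ _"] forall_2 comp J1 J2 block_app_frakL j0_def e0_def)
    with cf show ?thesis by (intro exI[of _ E] conjI)
  qed
  show "(\<lambda>x. frakL (L x) R_perp) has_effective_tensor frakL (matrix_inv N) R_perp"
    unfolding has_effective_tensor_def Ls_def[symmetric]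
  proof (intro conjI allI)
    show "frakL Ls R_perp \<in> Sym_pos" by (rule frakL_Sym_pos[OF Ls_sym Ls_half])
    fix E0
    from solution[of E0] obtain E where E: "cell_field (\<lambda>x. frakL (L x) R_perp) E0 E"
      "block_app (frakL Ls R_perp) E0 = (LINT x|cell_measure. block_app (frakL (L x) R_perp) (E x))"
      by (elim exE conjE)
    show "\<exists>E. cell_field (\<lambda>x. frakL (L x) R_perp) E0 E \<and>
        (\<forall>E'. cell_field (\<lambda>x. frakL (L x) R_perp) E0 E' \<longrightarrow> (AE x in cell_measure. E' x = E x)) \<and>
        block_app (frakL Ls R_perp) E0 = (LINT x|cell_measure. block_app (frakL (L x) R_perp) (E x))"
      using E cell_field_unique_AE[OF Spos E(1)] by (intro exI[of _ E] conjI allI impI)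
  qed
qed

text \<open>Integrability and invertibility are part of the conclusion because otherwise the
  integral and \<open>matrix_inv\<close> could be mere default values.\<close>

theorem mainTheorem2:
  fixes L :: "real^2 \<Rightarrow> real^2^2"
  assumes "composite (\<lambda>x. frakL (L x) R_perp)"
    and "\<And>x. transpose (L x) = L x"
    and "\<And>x. qf_less ((1/2) *\<^sub>R mat 1) (L x)"
  shows "integrable cell_measure (\<lambda>x. matrix_inv (L x)) \<and>
    invertible (LINT x|cell_measure. matrix_inv (L x)) \<and>
    (\<lambda>x. frakL (L x) R_perp) has_effective_tensor
      frakL (matrix_inv (LINT x|cell_measure. matrix_inv (L x))) R_perp"
proof -
  have "cell_periodic (\<lambda>x. frakL (L x) R_perp)"
    and m: "(\<lambda>x. frakL (L x) R_perp) \<in> borel_measurable lebesgue"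
    using assms(1) by (auto simp: composite_def)
  \<comment> \<open>The (1,1) block of the tensor is L itself, so periodicity and measurability of
    the composite descend to L.\<close>
  then have "frakL (L (x + axis i 1)) R_perp $ 1 $ 1 = frakL (L x) R_perp $ 1 $ 1" for x i
    by (simp add: cell_periodic_def)
  then have per: "cell_periodic L"
    by (simp add: cell_periodic_def frakL_entries)
  have "L \<in> borel_measurable lebesgue"
    using borel_measurable_nth2[OF borel_measurable_nth2[OF m], of 1 1] by (simp add: frakL_entries)
  then have "L \<in> borel_measurable cell_measure"
    by (rule measurable_restrict_space1)
  note tensor = frakL_has_effective_tensor[OF per this assms(2,3)]
  show ?thesis by (intro conjI tensor)
qed

end
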